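(* Let $\Phi$ and $\Psi$ be Turing functionals such that $\lambda_\Phi=\lambda_\Psi$ and $\lambda_\Phi$ is a computable semi-measure. Then $\Phi(\mathsf{MLR})=\Psi(\mathsf{MLR})$.
   Context: $2^\omega$ is Cantor space, $2^{<\omega}$ the set of finite binary strings, $\preceq$ the prefix order, $\varepsilon$ the empty string, and $\lambda$ the uniform (Lebesgue) measure on $2^\omega$. A Turing functional $\Phi$ is a c.e. set of pairs $(\sigma,\tau)$ of strings such that whenever $(\sigma,\tau),(\sigma',\tau')\in\Phi$ and $\sigma\preceq\sigma'$, the strings $\tau,\tau'$ are $\preceq$-comparable. For $X\in2^\omega$, $\Phi^X$ is the $\preceq$-maximal finite or infinite sequence extending every $\tau$ with $(\sigma,\tau)\in\Phi$ for some $\sigma\preceq X$; $\mathrm{dom}(\Phi)=\{X:\Phi^X\text{ is infinite}\}$, and for $X\in\mathrm{dom}(\Phi)$ we write $\Phi(X)=\Phi^X$. For $A\subseteq 2^\omega$, $\Phi(A)=\{\Phi(X):X\in A\cap\mathrm{dom}(\Phi)\}$. The semi-measure induced by $\Phi$ is $\lambda_\Phi(\sigma)=\lambda(\{X:\Phi^X\succeq\sigma\})$. A semi-measure is a function $\rho:2^{<\omega}\to[0,1]$ with $\rho(\varepsilon)=1$ and $\rho(\sigma)\ge\rho(\sigma0)+\rho(\sigma1)$; it is computable if there is a computable $\tilde\rho:2^{<\omega}\times\omega\to\mathbb{Q}$ with $|\rho(\sigma)-\tilde\rho(\sigma,i)|\le 2^{-i}$ for all $\sigma,i$. $\mathsf{MLR}$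 is the set of Martin-Löf random sequences with respect to $\lambda$. *)

theory Defs
  imports "HOL-Probability.Probability" "HOL-Library.Nat_Bijection" "HOL-Library.Sublist"
begin

text \<open>Primitive recursive functions of arity n, acting on argument lists of length n.\<close>
inductive prim_rec :: "nat \<Rightarrow> (nat list \<Rightarrow> nat) \<Rightarrow> bool" where
  pr_zero: "prim_rec n (\<lambda>_. 0)"
| pr_succ: "prim_rec 1 (\<lambda>xs. Suc (hd xs))"
| pr_proj: "i < n \<Longrightarrow> prim_rec n (\<lambda>xs. xs ! i)"
| pr_comp: "prim_rec m g \<Longrightarrow> length fs = m \<Longrightarrow> (\<forall>i<m. prim_rec n (fs ! i))
            \<Longrightarrow> prim_rec n (\<lambda>xs. g (map (\<lambda>f. f xs) fs))"
| pr_rec: "prim_rec n g \<Longrightarrow> prim_rec (Suc (Suc n)) h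
            \<Longrightarrow> prim_rec (Suc n) (\<lambda>xs. rec_nat (g (tl xs)) (\<lambda>k r. h (k # r # tl xs)) (hd xs))"

text \<open>Computably enumerable sets of naturals (Kleene normal form: Sigma-1 over a
  primitive recursive matrix).\<close>
definition ce_set :: "nat set \<Rightarrow> bool" where
  "ce_set A \<longleftrightarrow> (\<exists>f. prim_rec 2 f \<and> (\<forall>n. n \<in> A \<longleftrightarrow> (\<exists>m. f [n, m] = 0)))"

definition computable_fun :: "(nat \<Rightarrow> nat) \<Rightarrow> bool" where
  "computable_fun f \<longleftrightarrow> ce_set {prod_encode (n, f n) | n. True}"

type_synonym str = "bool list"
type_synonym cantor = "nat \<Rightarrow> bool"

definition code_str :: "str \<Rightarrow> nat" where
  "code_str \<sigma> = list_encode (map of_bool \<sigma>)"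

definition code_pair :: "str \<times> str \<Rightarrow> nat" where
  "code_pair p = prod_encode (code_str (fst p), code_str (snd p))"

definition init_seg :: "str \<Rightarrow> cantor \<Rightarrow> bool" where
  "init_seg \<sigma> X \<longleftrightarrow> (\<forall>i<length \<sigma>. X i = \<sigma> ! i)"

definition lam :: "cantor measure" where
  "lam = (\<Pi>\<^sub>M i\<in>UNIV. measure_pmf (bernoulli_pmf (1/2)))"

definition cyl :: "str set \<Rightarrow> cantor set" where
  "cyl U = {X. \<exists>\<sigma>\<in>U. init_seg \<sigma> X}"

definition turing_functional :: "(str \<times> str) set \<Rightarrow> bool" where
  "turing_functional \<Phi> \<longleftrightarrow> ce_set (code_pair ` \<Phi>) \<and>
     (\<forall>\<sigma> \<tau> \<sigma>' \<tau>'. (\<sigma>, \<tau>) \<in> \<Phi> \<longrightarrow> (\<sigma>', \<tau>') \<in> \<Phi> \<longrightarrow> prefix \<sigma> \<sigma>'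
        \<longrightarrow> (prefix \<tau> \<tau>' \<or> prefix \<tau>' \<tau>))"

text \<open>The finite outputs produced by \<Phi> on oracle X; \<Phi>^X is their supremum.\<close>
definition outs :: "(str \<times> str) set \<Rightarrow> cantor \<Rightarrow> str set" where
  "outs \<Phi> X = {\<tau>. \<exists>\<sigma>. (\<sigma>, \<tau>) \<in> \<Phi> \<and> init_seg \<sigma> X}"

text \<open>\<Phi>^X extends the string \<rho> (\<Phi>^X always extends the empty string).\<close>
definition out_ext :: "(str \<times> str) set \<Rightarrow> cantor \<Rightarrow> str \<Rightarrow> bool" where
  "out_ext \<Phi> X \<rho> \<longleftrightarrow> \<rho> = [] \<or> (\<exists>\<tau>\<in>outs \<Phi> X. prefix \<rho> \<tau>)"

definition dom_tf :: "(str \<times> str) set \<Rightarrow> cantor set" where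
  "dom_tf \<Phi> = {X. \<forall>n. \<exists>\<tau>\<in>outs \<Phi> X. n < length \<tau>}"

text \<open>\<Phi>(X) for X in the domain: bit n is read off any output of length > n.\<close>
definition apply_tf :: "(str \<times> str) set \<Rightarrow> cantor \<Rightarrow> cantor" where
  "apply_tf \<Phi> X = (\<lambda>n. THE b. \<exists>\<tau>\<in>outs \<Phi> X. n < length \<tau> \<and> \<tau> ! n = b)"

definition image_tf :: "(str \<times> str) set \<Rightarrow> cantor set \<Rightarrow> cantor set" where
  "image_tf \<Phi> A = apply_tf \<Phi> ` (A \<inter> dom_tf \<Phi>)"

definition induced :: "(str \<times> str) set \<Rightarrow> str \<Rightarrow> real" where
  "induced \<Phi> \<rho> = measure lam {X. out_ext \<Phi> X \<rho>}"

definition semimeasure :: "(str \<Rightarrow> real) \<Rightarrow> bool" where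
  "semimeasure \<rho> \<longleftrightarrow> (\<forall>\<sigma>. 0 \<le> \<rho> \<sigma> \<and> \<rho> \<sigma> \<le> 1) \<and> \<rho> [] = 1 \<and>
     (\<forall>\<sigma>. \<rho> \<sigma> \<ge> \<rho> (\<sigma> @ [False]) + \<rho> (\<sigma> @ [True]))"

definition dec_rat :: "nat \<Rightarrow> real" where
  "dec_rat k = (case prod_decode k of (a, r) \<Rightarrow>
      (case prod_decode r of (b, c) \<Rightarrow> (real a - real b) / (real c + 1)))"

definition computable_semimeasure :: "(str \<Rightarrow> real) \<Rightarrow> bool" where
  "computable_semimeasure \<rho> \<longleftrightarrow> semimeasure \<rho> \<and>
     (\<exists>g. computable_fun g \<and>
        (\<forall>\<sigma> i. \<bar>\<rho> \<sigma> - dec_rat (g (prod_encode (code_str \<sigma>, i)))\<bar> \<le> (1/2) ^ i))"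

definition ml_test :: "(nat \<times> str) set \<Rightarrow> bool" where
  "ml_test W \<longleftrightarrow> ce_set ((\<lambda>(n, \<sigma>). prod_encode (n, code_str \<sigma>)) ` W) \<and>
     (\<forall>n. measure lam (cyl {\<sigma>. (n, \<sigma>) \<in> W}) \<le> (1/2) ^ n)"

definition MLR :: "cantor set" where
  "MLR = {X. \<forall>W. ml_test W \<longrightarrow> \<not> (\<forall>n. X \<in> cyl {\<sigma>. (n, \<sigma>) \<in> W})}"

end

theory Submission
  imports Defs
begin

text \<open>Let \<open>X\<close> be random, \<open>Y = \<Phi>(X)\<close>, and let \<open>O\<^sub>n\<close> be the set of oracles on which \<open>\<Psi>\<close> extends \<open>Y\<restriction>n\<close>.
  For a Martin-Loef test \<open>T\<close>, the strings \<open>\<sigma>\<close> for which \<open>T\<^bsub>2p\<^esub>\<close> fills more than a proportion \<open>2\<^sup>-\<^sup>p\<close> of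
  \<open>{Z. \<Psi>\<^sup>Z \<succeq> \<sigma>}\<close> carry \<open>\<lambda>\<^sub>\<Psi>\<close>-weight, hence \<open>\<lambda>\<^sub>\<Phi>\<close>-weight, at most \<open>2\<^sup>-\<^sup>p\<close>; so the oracles that \<open>\<Phi>\<close> maps
  above such strings form a test again. As \<open>X\<close> passes it, there are arbitrarily large \<open>p\<close> for which
  \<open>T\<^bsub>2p\<^esub>\<close> fills at most a proportion \<open>2\<^sup>-\<^sup>p\<close> of every \<open>O\<^sub>n\<close>. There are countably many tests, so one component
  can be chosen from each of them such that their union \<open>V\<close> covers at most half of every \<open>O\<^sub>n\<close>; no universal
  test is needed. Computability of the semi-measure yields clopen subsets exhausting
  \<open>{Z. \<Psi>\<^sup>Z \<succeq> \<sigma>}\<close> up to a small error, and these errors form one of the tests. Hence \<open>O\<^sub>n\<close> agrees with a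
  clopen set outside \<open>V\<close>, and compactness gives a \<open>Z\<close> outside \<open>V\<close> that lies in every \<open>O\<^sub>n\<close>, that is,
  a random \<open>Z\<close> with \<open>\<Psi>(Z) = Y\<close>.\<close>

section \<open>Primitive recursive and Sigma-1 predicates\<close>

text \<open>Predicates and functions are handled as maps of an environment \<^typ>\<open>nat \<Rightarrow> nat\<close> of which only
  finitely many entries matter. Binders follow de Bruijn: the bound variable is entry 0 and the
  outer environment is shifted by one, so that membership in the classes below is proved by
  applying closure rules, without any bookkeeping of arities.\<close>

definition pr_fun :: "((nat \<Rightarrow> nat) \<Rightarrow> nat) \<Rightarrow> bool" where
  "pr_fun f \<longleftrightarrow> (\<exists>n g. prim_rec n g \<and> (\<forall>e. f e = g (map e [0..<n])))"

lemma prim_rec_weaken: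
  assumes "prim_rec n g" "n \<le> m"
  shows "\<exists>g'. prim_rec m g' \<and> (\<forall>e. g' (map e [0..<m]) = g (map e [0..<n]))"
proof -
  let ?fs = "map (\<lambda>i xs. xs ! i) [0..<n] :: (nat list \<Rightarrow> nat) list"
  have "prim_rec m (\<lambda>xs. g (map (\<lambda>f. f xs) ?fs))"
    by (rule pr_comp[OF assms(1)]) (use assms(2) in \<open>auto intro: pr_proj\<close>)
  moreover have "map (\<lambda>f. f (map e [0..<m])) ?fs = map e [0..<n]" for e :: "nat \<Rightarrow> nat"
    using assms(2) by (auto intro!: nth_equalityI)
  ultimately show ?thesis by (intro exI[of _ "\<lambda>xs. g (map (\<lambda>f. f xs) ?fs)"] conjI allI arg_cong[of _ _ g])
qed

text \<open>Functions of different arities are reconciled by taking a maximum: a representation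
  exists at every large enough arity, where the extra entries are ignored.\<close>

lemma pr_eventually:
  assumes "pr_fun f"
  shows "\<exists>n0. \<forall>n\<ge>n0. \<exists>g. prim_rec n g \<and> (\<forall>e. f e = g (map e [0..<n]))"
proof -
  obtain n0 g where g: "prim_rec n0 g" "\<And>e. f e = g (map e [0..<n0])" using assms unfolding pr_fun_def by auto
  show ?thesis
  proof (intro exI[of _ n0] allI impI)
    fix n assume "n0 \<le> n"
    from prim_rec_weaken[OF g(1) this] show "\<exists>g. prim_rec n g \<and> (\<forall>e. f e = g (map e [0..<n]))"
      using g(2) by (elim exE) (auto intro!: exI)
  qed
qed

lemma pr_comp_list:
  assumes g: "prim_rec (length fs) g" and fs: "\<forall>f\<in>set fs. pr_fun f"
  shows "pr_fun (\<lambda>e. g (map (\<lambda>f. f e) fs))"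
proof -
  have "\<exists>n0. \<forall>n\<ge>n0. \<exists>gs. length gs = length fs \<and> (\<forall>i<length fs. prim_rec n (gs ! i)) \<and>
      (\<forall>e. map (\<lambda>f. f e) fs = map (\<lambda>h. h (map e [0..<n])) gs)"
    using fs
  proof (induction fs)
    case Nil
    then show ?case by auto
  next
    case (Cons f fs)
    then obtain n0 where n0: "\<forall>n\<ge>n0. \<exists>gs. length gs = length fs \<and> (\<forall>i<length fs. prim_rec n (gs ! i)) \<and>
      (\<forall>e. map (\<lambda>f. f e) fs = map (\<lambda>h. h (map e [0..<n])) gs)" by auto
    have "pr_fun f" using Cons.prems by simp
    from pr_eventually[OF this] obtain n1 where
      n1: "\<forall>n\<ge>n1. \<exists>g. prim_rec n g \<and> (\<forall>e. f e = g (map e [0..<n]))" by auto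
    show ?case
    proof (intro exI[of _ "max n0 n1"] allI impI)
      fix n assume n: "n \<ge> max n0 n1"
      obtain gs where gs: "length gs = length fs" "\<forall>i<length fs. prim_rec n (gs ! i)"
        "\<forall>e. map (\<lambda>f. f e) fs = map (\<lambda>h. h (map e [0..<n])) gs" using n0 n by (meson max.boundedE)
      obtain g where g: "prim_rec n g" "\<forall>e. f e = g (map e [0..<n])" using n1 n by (meson max.boundedE)
      show "\<exists>gs. length gs = length (f # fs) \<and> (\<forall>i<length (f # fs). prim_rec n (gs ! i)) \<and>
        (\<forall>e. map (\<lambda>f. f e) (f # fs) = map (\<lambda>h. h (map e [0..<n])) gs)"
        using gs g by (intro exI[of _ "g # gs"]) (auto simp: nth_Cons split: nat.split)
    qed
  qed
  then obtain n gs where gs: "length gs = length fs" "\<forall>i<length fs. prim_rec n (gs ! i)"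
      "\<forall>e. map (\<lambda>f. f e) fs = map (\<lambda>h. h (map e [0..<n])) gs" by blast
  have "prim_rec n (\<lambda>xs. g (map (\<lambda>h. h xs) gs))"
    using pr_comp[OF g gs(1,2)] .
  then show ?thesis unfolding pr_fun_def using gs(3) by (intro exI[of _ n]) auto
qed

text \<open>Infinitely many functions are substituted, but \<open>f\<close> reads only finitely many
  entries, so this is an ordinary finite composition.\<close>

lemma pr_subst:
  assumes "pr_fun f" "\<And>i. pr_fun (s i)"
  shows "pr_fun (\<lambda>e. f (\<lambda>i. s i e))"
proof -
  obtain n g where g: "prim_rec n g" "\<forall>e. f e = g (map e [0..<n])" using assms(1) pr_fun_def by auto
  have "pr_fun (\<lambda>e. g (map (\<lambda>f. f e) (map s [0..<n])))"
    by (rule pr_comp_list) (use g assms(2) in auto)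
  then show ?thesis using g(2) by (simp add: comp_def)
qed

lemma pr_var: "pr_fun (\<lambda>e. e i)"
  unfolding pr_fun_def by (intro exI[of _ "Suc i"] exI[of _ "\<lambda>xs. xs ! i"]) (auto intro: pr_proj simp del: upt_Suc)

lemma pr_0: "pr_fun (\<lambda>e. 0)"
  unfolding pr_fun_def using pr_zero by auto

lemma pr_Suc: assumes "pr_fun f" shows "pr_fun (\<lambda>e. Suc (f e))"
  using pr_comp_list[of "[f]" "\<lambda>xs. Suc (hd xs)"] pr_succ assms by simp

lemma pr_const: "pr_fun (\<lambda>e. c)"
  by (induction c) (auto intro: pr_0 pr_Suc)

lemma pr_rec_nat:
  assumes f: "pr_fun f" and h: "pr_fun (\<lambda>e. h (e 0) (e (Suc 0)) (\<lambda>i. e (Suc (Suc i))))" and t: "pr_fun t"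
  shows "pr_fun (\<lambda>e. rec_nat (f e) (\<lambda>k r. h k r e) (t e))"
proof -
  obtain n0 where n0: "\<forall>n\<ge>n0. \<exists>g. prim_rec n g \<and> (\<forall>e. f e = g (map e [0..<n]))"
    using pr_eventually[OF f] by auto
  obtain n1 where n1: "\<forall>n\<ge>n1. \<exists>g. prim_rec n g \<and>
      (\<forall>e. h (e 0) (e (Suc 0)) (\<lambda>i. e (Suc (Suc i))) = g (map e [0..<n]))"
    using pr_eventually[OF h] by auto
  let ?n = "max n0 n1"
  obtain g where g: "prim_rec ?n g" "\<And>e. f e = g (map e [0..<?n])" using n0 by (meson max.cobounded1)
  have "n1 \<le> Suc (Suc ?n)" by auto
  then obtain g' where g': "prim_rec (Suc (Suc ?n)) g'"
    "\<And>e. h (e 0) (e (Suc 0)) (\<lambda>i. e (Suc (Suc i))) = g' (map e [0..<Suc (Suc ?n)])" using n1 by blast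
  let ?r = "\<lambda>xs. rec_nat (g (tl xs)) (\<lambda>k r. g' (k # r # tl xs)) (hd xs)"
  have r: "prim_rec (Suc ?n) ?r" using pr_rec[OF g(1) g'(1)] .
  have upt: "map e [0..<Suc m] = e 0 # map (\<lambda>i. e (Suc i)) [0..<m]" for e :: "nat \<Rightarrow> nat" and m
    by (simp add: upt_conv_Cons map_Suc_upt[symmetric] comp_def del: upt_Suc)
  have h_eq: "h k r e = g' (k # r # map e [0..<?n])" for k r e
    using g'(2)[of "case_nat k (case_nat r e)"] by (simp add: upt del: upt_Suc)
  have "pr_fun (\<lambda>e. rec_nat (f (\<lambda>i. e (Suc i))) (\<lambda>k r. h k r (\<lambda>i. e (Suc i))) (e 0))"
    unfolding pr_fun_def
    by (intro exI[of _ "Suc ?n"] exI[of _ ?r] conjI r) (simp add: upt g(2) h_eq del: upt_Suc)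
  \<comment> \<open>The recursion above runs up to entry 0 of an environment shifted by one; putting
    \<open>t\<close> there and \<open>e j\<close> at position \<open>Suc j\<close> undoes the
    shift.\<close>
  from pr_subst[OF this, of "\<lambda>i. case i of 0 \<Rightarrow> t | Suc j \<Rightarrow> (\<lambda>e. e j)"]
  show ?thesis using t by (auto simp: pr_var split: nat.split)
qed

section \<open>Arithmetic, decidable predicates and bounded search\<close>

lemma pr_add: assumes "pr_fun f" "pr_fun g" shows "pr_fun (\<lambda>e. f e + g e)"
proof -
  have "pr_fun (\<lambda>e. rec_nat (g e) (\<lambda>k r. Suc r) (f e))"
    by (intro pr_rec_nat pr_Suc pr_var assms)
  moreover have "rec_nat b (\<lambda>k r. Suc r) a = a + b" for a b by (induction a) auto
  ultimately show ?thesis by simp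
qed

lemma pr_mult: assumes "pr_fun f" "pr_fun g" shows "pr_fun (\<lambda>e. f e * g e)"
proof -
  have "pr_fun (\<lambda>e. rec_nat 0 (\<lambda>k r. r + g e) (f e))"
    by (intro pr_rec_nat pr_add pr_0 pr_var assms pr_subst[OF assms(2)])
  moreover have "rec_nat 0 (\<lambda>k r. r + b) a = a * b" for a b :: nat by (induction a) auto
  ultimately show ?thesis by simp
qed

lemma pr_sum:
  assumes "pr_fun (\<lambda>e. f (e 0) (\<lambda>i. e (Suc i)))" "pr_fun t"
  shows "pr_fun (\<lambda>e. \<Sum>k<t e. f k e)"
proof -
  \<comment> \<open>The substitution skips entry 1, which holds the running sum that
    \<open>f\<close> does not see.\<close>
  have "pr_fun (\<lambda>e. rec_nat 0 (\<lambda>k r. r + f k e) (t e))"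
    by (intro pr_rec_nat pr_add pr_0 pr_var assms
      pr_subst[OF assms(1), of "\<lambda>i. case i of 0 \<Rightarrow> \<lambda>e. e 0 | Suc j \<Rightarrow> (\<lambda>e. e (Suc (Suc j)))", simplified])
      (auto split: nat.split intro: pr_var)
  moreover have "rec_nat 0 (\<lambda>k r. r + f k e) a = (\<Sum>k<a. f k e)" for a e by (induction a) auto
  ultimately show ?thesis by simp
qed

lemma pr_power: assumes "pr_fun f" "pr_fun g" shows "pr_fun (\<lambda>e. f e ^ g e)"
proof -
  have "pr_fun (\<lambda>e. rec_nat 1 (\<lambda>k r. r * f e) (g e))"
    by (intro pr_rec_nat pr_mult pr_const pr_var assms pr_subst[OF assms(1)])
  moreover have "rec_nat 1 (\<lambda>k r. r * b) a = b ^ a" for a b :: nat by (induction a) auto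
  ultimately show ?thesis by simp
qed

lemma pr_diff: assumes "pr_fun f" "pr_fun g" shows "pr_fun (\<lambda>e. f e - g e)"
proof -
  have pred: "pr_fun (\<lambda>e. rec_nat 0 (\<lambda>k r. k) (t e))" if "pr_fun t" for t
    by (intro pr_rec_nat pr_0 pr_var that)
  have "pr_fun (\<lambda>e. rec_nat (f e) (\<lambda>k r. rec_nat 0 (\<lambda>k r. k) r) (g e))"
    by (intro pr_rec_nat pred pr_var assms)
  moreover have "rec_nat 0 (\<lambda>k r. k) a = a - 1" for a :: nat by (cases a) auto
  moreover have "rec_nat b (\<lambda>k r. r - 1) a = b - a" for a b :: nat by (induction a) auto
  ultimately show ?thesis by simp
qed

definition pr_pred :: "((nat \<Rightarrow> nat) \<Rightarrow> bool) \<Rightarrow> bool" where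
  "pr_pred P \<longleftrightarrow> pr_fun (\<lambda>e. of_bool (P e))"

lemma pr_pred_le: assumes "pr_fun f" "pr_fun g" shows "pr_pred (\<lambda>e. f e \<le> g e)"
proof -
  have "pr_fun (\<lambda>e. 1 - (f e - g e))" by (intro pr_diff pr_const assms)
  moreover have "of_bool (a \<le> b) = 1 - (a - b)" for a b :: nat by auto
  ultimately show ?thesis by (simp add: pr_pred_def)
qed

lemma pr_pred_not: assumes "pr_pred P" shows "pr_pred (\<lambda>e. \<not> P e)"
proof -
  have "pr_fun (\<lambda>e. 1 - of_bool (P e))" using assms by (intro pr_diff pr_const) (simp add: pr_pred_def)
  moreover have "of_bool (\<not> p) = (1 - of_bool p :: nat)" for p by auto
  ultimately show ?thesis by (simp add: pr_pred_def)
qed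

lemma pr_pred_conj: assumes "pr_pred P" "pr_pred Q" shows "pr_pred (\<lambda>e. P e \<and> Q e)"
  using assms unfolding pr_pred_def of_bool_conj by (intro pr_mult)

lemma pr_pred_disj: assumes "pr_pred P" "pr_pred Q" shows "pr_pred (\<lambda>e. P e \<or> Q e)"
  using pr_pred_not[OF pr_pred_conj[OF pr_pred_not[OF assms(1)] pr_pred_not[OF assms(2)]]] by simp

lemma pr_pred_less: assumes "pr_fun f" "pr_fun g" shows "pr_pred (\<lambda>e. f e < g e)"
  using pr_pred_not[OF pr_pred_le[OF assms(2,1)]] by (simp add: not_le)

lemma pr_pred_eq: assumes "pr_fun f" "pr_fun g" shows "pr_pred (\<lambda>e. f e = g e)"
  using pr_pred_conj[OF pr_pred_le[OF assms] pr_pred_le[OF assms(2,1)]] by (simp add: order_eq_iff)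

lemma pr_pred_subst:
  assumes "pr_pred P" "\<And>i. pr_fun (s i)"
  shows "pr_pred (\<lambda>e. P (\<lambda>i. s i e))"
  using assms pr_subst[of "\<lambda>e. of_bool (P e)" s] unfolding pr_pred_def by blast

lemma card_eq_sum_of_bool: "card {k. k < n \<and> P k} = (\<Sum>k<(n::nat). of_bool (P k))"
proof -
  have "{k. k < n \<and> P k} = {..<n} \<inter> {k. P k}" by auto
  then show ?thesis by simp
qed

text \<open>Counting is bounded summation of a characteristic function. It serves bounded
  quantification and, later, the measures of clopen sets.\<close>

lemma pr_card:
  assumes "pr_pred (\<lambda>e. P (e 0) (\<lambda>i. e (Suc i)))" "pr_fun t"
  shows "pr_fun (\<lambda>e. card {k. k < t e \<and> P k e})"
  unfolding card_eq_sum_of_bool using assms unfolding pr_pred_def by (intro pr_sum)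

lemma pr_pred_bex:
  assumes "pr_pred (\<lambda>e. P (e 0) (\<lambda>i. e (Suc i)))" "pr_fun t"
  shows "pr_pred (\<lambda>e. \<exists>k<t e. P k e)"
proof -
  have "pr_pred (\<lambda>e. 0 < card {k. k < t e \<and> P k e})" by (intro pr_pred_less pr_card pr_const assms)
  moreover have "0 < card {k. k < t e \<and> P k e} \<longleftrightarrow> (\<exists>k<t e. P k e)" for e
    by (auto simp: card_gt_0_iff)
  ultimately show ?thesis by simp
qed

lemma pr_of_bool: "pr_pred P \<Longrightarrow> pr_fun (\<lambda>e. of_bool (P e))"
  by (simp add: pr_pred_def)

lemma pr_if: assumes "pr_pred P" "pr_fun f" "pr_fun g" shows "pr_fun (\<lambda>e. if P e then f e else g e)"
proof -
  have "pr_fun (\<lambda>e. of_bool (P e) * f e + of_bool (\<not> P e) * g e)"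
    by (intro pr_add pr_mult pr_of_bool pr_pred_not assms)
  moreover have "(\<lambda>e. of_bool (P e) * f e + of_bool (\<not> P e) * g e) = (\<lambda>e. if P e then f e else g e)"
    by auto
  ultimately show ?thesis by simp
qed

lemma pr_mod: assumes "pr_fun f" "pr_fun g" shows "pr_fun (\<lambda>e. f e mod g e)"
proof -
  \<comment> \<open>The remainder is counted up cyclically; for divisor 0 it is never reset, which
    agrees with \<open>a mod 0 = a\<close>.\<close>
  have "pr_fun (\<lambda>e. rec_nat 0 (\<lambda>k r. if Suc r = g e then 0 else Suc r) (f e))"
    by (intro pr_rec_nat pr_if pr_pred_eq pr_Suc pr_const pr_var assms pr_subst[OF assms(2)])
  moreover have "rec_nat 0 (\<lambda>k r. if Suc r = b then 0 else Suc r) a = a mod b" for a b :: nat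
    by (induction a) (auto simp: mod_Suc)
  ultimately show ?thesis by simp
qed

lemma pr_div: assumes "pr_fun f" "pr_fun g" shows "pr_fun (\<lambda>e. f e div g e)"
proof -
  have "pr_fun (\<lambda>e. rec_nat 0 (\<lambda>k r. if Suc k mod g e = 0 then Suc r else r) (f e))"
    by (intro pr_rec_nat pr_if pr_pred_eq pr_mod pr_Suc pr_const pr_var assms pr_subst[OF assms(2)])
  moreover have "rec_nat 0 (\<lambda>k r. if Suc k mod b = 0 then Suc r else r) a = a div b" for a b :: nat
    by (induction a) (auto simp: div_Suc)
  ultimately show ?thesis by simp
qed

lemma pr_prod_encode: assumes "pr_fun f" "pr_fun g" shows "pr_fun (\<lambda>e. prod_encode (f e, g e))"
  unfolding prod_encode_def triangle_def prod.case
  by (intro pr_add pr_div pr_mult pr_Suc pr_const assms)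

lemmas pr_intros = pr_var pr_const pr_Suc pr_add pr_mult pr_sum pr_power pr_diff pr_card pr_of_bool
  pr_if pr_mod pr_div pr_prod_encode pr_pred_le pr_pred_not pr_pred_conj pr_pred_disj pr_pred_less pr_pred_eq pr_pred_bex

section \<open>Enumerable predicates and their closure properties\<close>

definition pr_matrix :: "(nat \<Rightarrow> (nat \<Rightarrow> nat) \<Rightarrow> bool) \<Rightarrow> bool" where
  "pr_matrix R \<longleftrightarrow> pr_pred (\<lambda>e. R (e 0) (\<lambda>i. e (Suc i)))"

definition sigma1 :: "((nat \<Rightarrow> nat) \<Rightarrow> bool) \<Rightarrow> bool" where
  "sigma1 P \<longleftrightarrow> (\<exists>R. pr_matrix R \<and> (\<forall>e. P e \<longleftrightarrow> (\<exists>m. R m e)))"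

lemma sigma1I:
  assumes "pr_pred (\<lambda>e. R (e 0) (\<lambda>i. e (Suc i)))" "\<And>e. P e \<longleftrightarrow> (\<exists>m. R m e)"
  shows "sigma1 P"
  unfolding sigma1_def using assms by (intro exI[of _ R]) (simp add: pr_matrix_def)

lemma sigma1E:
  assumes "sigma1 P"
  obtains R where "pr_matrix R" "\<And>e. P e \<longleftrightarrow> (\<exists>m. R m e)"
  using assms unfolding sigma1_def by blast

lemma pr_pred_subst2:
  assumes "pr_matrix R" "pr_fun t" "\<And>i. pr_fun (s i)"
  shows "pr_pred (\<lambda>e. R (t e) (\<lambda>i. s i e))"
  using pr_pred_subst[OF assms(1)[unfolded pr_matrix_def], of "\<lambda>i. case i of 0 \<Rightarrow> t | Suc j \<Rightarrow> s j"] assms(2,3)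
  by (auto split: nat.split)

lemma sigma1_subst:
  assumes "sigma1 P" "\<And>i. pr_fun (s i)"
  shows "sigma1 (\<lambda>e. P (\<lambda>i. s i e))"
proof -
  obtain R where R: "pr_matrix R" "\<And>e. P e \<longleftrightarrow> (\<exists>m. R m e)"
    using sigma1E[OF assms(1)] by blast
  show ?thesis
    by (rule sigma1I[of "\<lambda>m e. R m (\<lambda>i. s i e)"])
      (auto simp: R(2) intro!: pr_pred_subst2[OF R(1)] pr_var pr_subst[OF assms(2)])
qed

lemma sigma1_dp: "pr_pred P \<Longrightarrow> sigma1 P"
  by (rule sigma1I[of "\<lambda>_. P"]) (auto intro: pr_pred_subst pr_var)

text \<open>One number bounding both the quantified value and its witness replaces the two of them,
  leaving a bounded search under a single unbounded quantifier.\<close>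

lemma sigma1_ex:
  assumes "sigma1 (\<lambda>e. Q (e 0) (\<lambda>i. e (Suc i)))"
  shows "sigma1 (\<lambda>e. \<exists>k. Q k e)"
proof -
  obtain R where R: "pr_matrix R"
    "\<And>e. Q (e 0) (\<lambda>i. e (Suc i)) \<longleftrightarrow> (\<exists>m. R m e)"
    using sigma1E[OF assms] by blast
  have Q: "Q k e \<longleftrightarrow> (\<exists>m. R m (case_nat k e))" for k e
    using R(2)[of "case_nat k e"] by simp
  show ?thesis
  proof (rule sigma1I[of "\<lambda>b e. \<exists>m<b. \<exists>k<b. R m (case_nat k e)"])
    show "pr_pred (\<lambda>e. \<exists>m<e 0. \<exists>k<e 0. R m (case_nat k (\<lambda>i. e (Suc i))))"
    proof (intro pr_pred_bex pr_var)
      \<comment> \<open>Below both bounded quantifiers, entry 0 is \<open>k\<close>, entry 1 is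
        \<open>m\<close>, entry 2 is the bound, and the original environment starts at entry
        3.\<close>
      have "pr_pred (\<lambda>e. R (e (Suc 0)) (\<lambda>i. (case i of 0 \<Rightarrow> \<lambda>e. e 0 | Suc j \<Rightarrow> \<lambda>e. e (Suc (Suc (Suc j)))) e))"
        by (rule pr_pred_subst2[OF R(1)]) (auto split: nat.split intro: pr_var)
      moreover have "(\<lambda>i. (case i of 0 \<Rightarrow> \<lambda>e. e 0 | Suc j \<Rightarrow> \<lambda>e. e (Suc (Suc (Suc j)))) e) =
         case_nat (e 0) (\<lambda>i. e (Suc (Suc (Suc i))))" for e :: "nat \<Rightarrow> nat" by (auto split: nat.split)
      ultimately show "pr_pred (\<lambda>e. R (e (Suc 0)) (case_nat (e 0) (\<lambda>i. e (Suc (Suc (Suc i))))))" by simp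
    qed
    show "(\<exists>k. Q k e) \<longleftrightarrow> (\<exists>b. \<exists>m<b. \<exists>k<b. R m (case_nat k e))" for e
    proof
      assume "\<exists>k. Q k e"
      then obtain k m where "R m (case_nat k e)" using Q by blast
      then show "\<exists>b. \<exists>m<b. \<exists>k<b. R m (case_nat k e)"
        by (intro exI[of _ "Suc (max m k)"] exI[of _ m] exI[of _ k] conjI) auto
    qed (use Q in blast)
  qed
qed

lemma sigma1_conj: assumes "sigma1 P" "sigma1 Q" shows "sigma1 (\<lambda>e. P e \<and> Q e)"
proof -
  obtain R where R: "pr_matrix R" "\<And>e. P e \<longleftrightarrow> (\<exists>m. R m e)"
    using sigma1E[OF assms(1)] by blast
  obtain S where S: "pr_matrix S" "\<And>e. Q e \<longleftrightarrow> (\<exists>m. S m e)"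
    using sigma1E[OF assms(2)] by blast
  have "sigma1 (\<lambda>e. \<exists>m n. R m e \<and> S n e)"
    by (intro sigma1_ex sigma1_dp pr_pred_conj pr_pred_subst2[OF R(1)] pr_pred_subst2[OF S(1)] pr_var)
  then show ?thesis using R(2) S(2) by simp
qed

lemma sigma1_disj: assumes "sigma1 P" "sigma1 Q" shows "sigma1 (\<lambda>e. P e \<or> Q e)"
proof -
  obtain R where R: "pr_matrix R" "\<And>e. P e \<longleftrightarrow> (\<exists>m. R m e)"
    using sigma1E[OF assms(1)] by blast
  obtain S where S: "pr_matrix S" "\<And>e. Q e \<longleftrightarrow> (\<exists>m. S m e)"
    using sigma1E[OF assms(2)] by blast
  have "sigma1 (\<lambda>e. \<exists>m. R m e \<or> S m e)"
    by (intro sigma1_ex sigma1_dp pr_pred_disj pr_pred_subst2[OF R(1)] pr_pred_subst2[OF S(1)] pr_var)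
  then show ?thesis using R(2) S(2) by (simp add: ex_disj_distrib)
qed

text \<open>The common bound on the witnesses replaces a coding of finite sequences of witnesses.\<close>

lemma sigma1_le_card:
  assumes "sigma1 (\<lambda>e. Q (e 0) (\<lambda>i. e (Suc i)))" "pr_fun w" "pr_fun t"
  shows "sigma1 (\<lambda>e. w e \<le> card {k. k < t e \<and> Q k e})"
proof -
  obtain R where R: "pr_matrix R"
    "\<And>e. Q (e 0) (\<lambda>i. e (Suc i)) \<longleftrightarrow> (\<exists>m. R m e)"
    using sigma1E[OF assms(1)] by blast
  have Q: "Q k e \<longleftrightarrow> (\<exists>m. R m (case_nat k e))" for k e
    using R(2)[of "case_nat k e"] by simp
  have dpR: "pr_pred (\<lambda>e. R (e 0) (case_nat (e (Suc 0)) (\<lambda>i. e (Suc (Suc (Suc i))))))"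
  proof -
    have "pr_pred (\<lambda>e. R (e 0) (\<lambda>i. (case i of 0 \<Rightarrow> \<lambda>e. e (Suc 0) | Suc j \<Rightarrow> \<lambda>e. e (Suc (Suc (Suc j)))) e))"
      by (rule pr_pred_subst2[OF R(1)]) (auto split: nat.split intro: pr_var)
    moreover have "(\<lambda>i. (case i of 0 \<Rightarrow> \<lambda>e. e (Suc 0) | Suc j \<Rightarrow> \<lambda>e. e (Suc (Suc (Suc j)))) e) =
       case_nat (e (Suc 0)) (\<lambda>i. e (Suc (Suc (Suc i))))" for e :: "nat \<Rightarrow> nat" by (auto split: nat.split)
    ultimately show ?thesis by simp
  qed
  show ?thesis
  proof (rule sigma1I[of "\<lambda>b e. w e \<le> card {k. k < t e \<and> (\<exists>m<b. R m (case_nat k e))}"])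
    show "pr_pred (\<lambda>e. w (\<lambda>i. e (Suc i)) \<le> card {k. k < t (\<lambda>i. e (Suc i)) \<and>
       (\<exists>m<e 0. R m (case_nat k (\<lambda>i. e (Suc i))))})"
      by (intro pr_pred_le pr_card pr_pred_bex dpR pr_subst[OF assms(2)] pr_subst[OF assms(3)] pr_var)
    show "w e \<le> card {k. k < t e \<and> Q k e} \<longleftrightarrow>
      (\<exists>b. w e \<le> card {k. k < t e \<and> (\<exists>m<b. R m (case_nat k e))})" for e
    proof
      assume w: "w e \<le> card {k. k < t e \<and> Q k e}"
      define f where "f k = (SOME m. R m (case_nat k e))" for k
      have f: "R (f k) (case_nat k e)" if "Q k e" for k
        using that unfolding Q f_def by (rule someI_ex)
      have "{k. k < t e \<and> Q k e} \<subseteq> {k. k < t e \<and> (\<exists>m<Suc (Max (f ` {..<t e})). R m (case_nat k e))}"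
        using f by (auto simp: less_Suc_eq_le intro!: exI Max_ge)
      then have "card {k. k < t e \<and> Q k e} \<le>
         card {k. k < t e \<and> (\<exists>m<Suc (Max (f ` {..<t e})). R m (case_nat k e))}"
        by (intro card_mono) auto
      then show "\<exists>b. w e \<le> card {k. k < t e \<and> (\<exists>m<b. R m (case_nat k e))}"
        using w order_trans by blast
    next
      assume "\<exists>b. w e \<le> card {k. k < t e \<and> (\<exists>m<b. R m (case_nat k e))}"
      then obtain b where b: "w e \<le> card {k. k < t e \<and> (\<exists>m<b. R m (case_nat k e))}" ..
      have "card {k. k < t e \<and> (\<exists>m<b. R m (case_nat k e))} \<le> card {k. k < t e \<and> Q k e}"
        using Q by (intro card_mono) auto
      then show "w e \<le> card {k. k < t e \<and> Q k e}" using b by simp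
    qed
  qed
qed

text \<open>This connects the normal form over argument lists with predicates of environments, so
  that enumerability can be proved by closure rules.\<close>

lemma ce_set_iff_sigma1: "ce_set A \<longleftrightarrow> sigma1 (\<lambda>e. e 0 \<in> A)"
proof
  assume "ce_set A"
  then obtain f where f: "prim_rec 2 f" "\<And>n. n \<in> A \<longleftrightarrow> (\<exists>m. f [n, m] = 0)" unfolding ce_set_def by auto
  have "pr_fun (\<lambda>e. f [e 1, e 0])"
    using pr_comp_list[of "[\<lambda>e. e 1, \<lambda>e. e 0]" f] f(1) by (auto intro: pr_var simp: numeral_2_eq_2)
  then have "pr_pred (\<lambda>e. f [e 1, e 0] = 0)" by (intro pr_pred_eq pr_const)
  then show "sigma1 (\<lambda>e. e 0 \<in> A)" by (intro sigma1I[of "\<lambda>m e. f [e 0, m] = 0"]) (auto simp: f(2))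
next
  assume "sigma1 (\<lambda>e. e 0 \<in> A)"
  then obtain R where R: "pr_matrix R" "\<And>e. e 0 \<in> A \<longleftrightarrow> (\<exists>m. R m e)"
    by (elim sigma1E) blast
  \<comment> \<open>The matrix may read further entries, so all except the witness and the tested
    number are set to 0. It is negated because the normal form asks for the value 0.\<close>
  have "pr_pred (\<lambda>e. \<not> R (e 0) (\<lambda>i. (case i of 0 \<Rightarrow> \<lambda>e. e (Suc 0) | Suc j \<Rightarrow> \<lambda>e. 0) e))"
    by (intro pr_pred_not pr_pred_subst2[OF R(1)]) (auto split: nat.split intro: pr_intros)
  then obtain n g where g: "prim_rec n g"
    "\<And>e. of_bool (\<not> R (e 0) (\<lambda>i. (case i of 0 \<Rightarrow> \<lambda>e. e (Suc 0) | Suc j \<Rightarrow> \<lambda>e. 0) e)) = g (map e [0..<n])"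
    unfolding pr_pred_def pr_fun_def by blast
  \<comment> \<open>The lists \<open>[x, m]\<close> have the witness last and the environments have
    it first, hence the swapped projections.\<close>
  let ?fs = "map (\<lambda>i. if i = 0 then (\<lambda>xs. xs ! 1) else if i = 1 then (\<lambda>xs. xs ! 0) else (\<lambda>xs. 0)) [0..<n] :: (nat list \<Rightarrow> nat) list"
  have "prim_rec 2 (\<lambda>xs. g (map (\<lambda>f. f xs) ?fs))"
    by (rule pr_comp[OF g(1)]) (auto intro: pr_proj pr_zero split: if_splits)
  moreover have "g (map (\<lambda>f. f [x, m]) ?fs) = 0 \<longleftrightarrow> R m (case_nat x (\<lambda>_. 0))" for x m
  proof -
    have "map (\<lambda>f. f [x, m]) ?fs = map (\<lambda>i. if i = 0 then m else if i = 1 then x else 0) [0..<n]"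
      by auto
    then have "g (map (\<lambda>f. f [x, m]) ?fs) =
      of_bool (\<not> R m (\<lambda>i. (case i of 0 \<Rightarrow> \<lambda>e. e (Suc 0) | Suc j \<Rightarrow> \<lambda>e. 0)
        (\<lambda>i. if i = 0 then m else if i = 1 then x else (0::nat))))"
      using g(2)[of "\<lambda>i. if i = 0 then m else if i = 1 then x else 0"] by (simp only: if_True simp_thms)
    also have "(\<lambda>i. (case i of 0 \<Rightarrow> \<lambda>e. e (Suc 0) | Suc j \<Rightarrow> \<lambda>e. 0)
        (\<lambda>i. if i = 0 then m else if i = 1 then x else (0::nat))) = case_nat x (\<lambda>_. 0)"
      by (auto split: nat.split)
    finally show ?thesis by simp
  qed
  moreover have "x \<in> A \<longleftrightarrow> (\<exists>m. R m (case_nat x (\<lambda>_. 0)))" for x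
    using R(2)[of "case_nat x (\<lambda>_. 0)"] by simp
  ultimately show "ce_set A" unfolding ce_set_def by (intro exI[of _ "\<lambda>xs. g (map (\<lambda>f. f xs) ?fs)"]) simp
qed

lemma sigma1_mem: assumes "ce_set A" "pr_fun f" shows "sigma1 (\<lambda>e. f e \<in> A)"
  using sigma1_subst[of "\<lambda>e. e 0 \<in> A" "\<lambda>_. f"] assms by (simp add: ce_set_iff_sigma1)

section \<open>Strings as pairs of numbers\<close>

text \<open>Strings are read in binary with the least significant bit first, so that truncating a string
  leaves the number unchanged up to a remainder.\<close>

fun str_val :: "str \<Rightarrow> nat" where
  "str_val [] = 0"
| "str_val (b # s) = of_bool b + 2 * str_val s"

fun str_of :: "nat \<Rightarrow> nat \<Rightarrow> str" where
  "str_of 0 k = []"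
| "str_of (Suc l) k = odd k # str_of l (k div 2)"

lemma length_str_of [simp]: "length (str_of l k) = l"
  by (induction l k rule: str_of.induct) auto

lemma str_val_str_of: "str_val (str_of l k) = k mod 2 ^ l"
proof (induction l k rule: str_of.induct)
  case (2 l k)
  have "k mod (2 * 2 ^ l) = 2 * (k div 2 mod 2 ^ l) + k mod 2" by (rule mod_mult2_eq)
  then show ?case using 2 by (auto simp: mod_2_eq_odd)
qed simp

lemma str_of_str_val [simp]: "str_of (length s) (str_val s) = s"
  by (induction s) auto

lemma str_val_less: "str_val s < 2 ^ length s"
  by (induction s) auto

lemma take_str_of: "take a (str_of l k) = str_of (min a l) k"
proof (induction l k arbitrary: a rule: str_of.induct)
  case (2 l k)
  then show ?case by (cases a) auto
qed simp

lemma str_val_take: "str_val (take a s) = str_val s mod 2 ^ a"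
proof -
  have "str_val (take a (str_of (length s) (str_val s))) = str_val s mod 2 ^ min a (length s)"
    unfolding take_str_of str_val_str_of ..
  also have "\<dots> = str_val s mod 2 ^ a"
  proof (cases "a \<le> length s")
    case False
    then have "(2::nat) ^ length s \<le> 2 ^ a" by (intro power_increasing) auto
    then have "str_val s < 2 ^ a" using str_val_less[of s] by (rule less_le_trans[rotated])
    then show ?thesis using False str_val_less[of s] by simp
  qed simp
  finally show ?thesis by simp
qed

lemma str_eq_iff: "s = t \<longleftrightarrow> length s = length t \<and> str_val s = str_val t"
proof
  assume "length s = length t \<and> str_val s = str_val t"
  then have "str_of (length s) (str_val s) = str_of (length t) (str_val t)" by simp
  then show "s = t" by simp
qed simp

lemma inj_code_str: "inj code_str"
proof -
  have "inj (map (of_bool :: bool \<Rightarrow> nat))" by (intro inj_mapI) (auto simp: inj_on_def)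
  then have "inj (list_encode \<circ> map of_bool)" by (intro inj_compose inj_list_encode)
  moreover have "code_str = list_encode \<circ> map of_bool" by (auto simp: code_str_def)
  ultimately show ?thesis by (simp only:)
qed

section \<open>Primitive recursive string functions\<close>

definition pr_str :: "((nat \<Rightarrow> nat) \<Rightarrow> str) \<Rightarrow> bool" where
  "pr_str f \<longleftrightarrow> pr_fun (\<lambda>e. length (f e)) \<and> pr_fun (\<lambda>e. str_val (f e))"

lemma pr_length: "pr_str f \<Longrightarrow> pr_fun (\<lambda>e. length (f e))"
  by (simp add: pr_str_def)

lemma pr_str_str_of: "pr_fun t \<Longrightarrow> pr_fun u \<Longrightarrow> pr_str (\<lambda>e. str_of (t e) (u e))"
  unfolding pr_str_def str_val_str_of length_str_of by (intro conjI pr_intros)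

lemma pr_str_const: "pr_str (\<lambda>e. s)"
  unfolding pr_str_def by (intro conjI pr_const)

lemma pr_str_take: "pr_fun t \<Longrightarrow> pr_str f \<Longrightarrow> pr_str (\<lambda>e. take (t e) (f e))"
  unfolding pr_str_def str_val_take length_take min_def by (elim conjE, intro conjI pr_intros)

lemma pr_str_subst:
  assumes "pr_str f" "\<And>i. pr_fun (s i)"
  shows "pr_str (\<lambda>e. f (\<lambda>i. s i e))"
  using pr_subst[of "\<lambda>e. length (f e)" s] pr_subst[of "\<lambda>e. str_val (f e)" s] assms unfolding pr_str_def by blast

lemma pr_pred_str_eq: "pr_str f \<Longrightarrow> pr_str g \<Longrightarrow> pr_pred (\<lambda>e. f e = g e)"
  unfolding pr_str_def str_eq_iff by (intro pr_pred_conj pr_pred_eq) auto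

lemma pr_pred_prefix: assumes "pr_str f" "pr_str g" shows "pr_pred (\<lambda>e. prefix (f e) (g e))"
proof -
  have "prefix s t \<longleftrightarrow> take (length s) t = s" for s t :: str
    by (auto simp: prefix_def append_eq_conv_conj) (metis append_take_drop_id)
  then have "(\<lambda>e. prefix (f e) (g e)) = (\<lambda>e. take (length (f e)) (g e) = f e)" by auto
  then show ?thesis using assms by (simp only:) (intro pr_pred_str_eq pr_str_take pr_length)
qed

lemma pr_code_str: assumes "pr_str f" shows "pr_fun (\<lambda>e. code_str (f e))"
proof -
  \<comment> \<open>\<open>list_encode\<close> is built up from the tail, so the bits are read from
    the last to the first: after \<open>j\<close> steps the recursion holds the code of the last
    \<open>j\<close> bits.\<close>
  let ?c = "\<lambda>k l. rec_nat 0 (\<lambda>j r. Suc (prod_encode (k div 2 ^ (l - Suc j) mod 2, r)))"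
  have *: "?c k l j = code_str (str_of j (k div 2 ^ (l - j)))" if "j \<le> l" for j k l :: nat
    using that
  proof (induction j)
    case 0
    then show ?case by (simp add: code_str_def)
  next
    case (Suc j)
    have "k div 2 ^ (l - Suc j) div 2 = k div 2 ^ Suc (l - Suc j)"
      by (simp add: div_mult2_eq[symmetric] mult.commute)
    also have "Suc (l - Suc j) = l - j" using Suc.prems by simp
    finally show ?case using Suc by (simp add: code_str_def mod_2_eq_odd)
  qed
  have v: "pr_fun (\<lambda>e. str_val (f e))" and l: "pr_fun (\<lambda>e. length (f e))" using assms by (auto simp: pr_str_def)
  have "pr_fun (\<lambda>e. ?c (str_val (f e)) (length (f e)) (length (f e)))"
    by (intro pr_rec_nat pr_intros pr_subst[OF v] pr_subst[OF l])
  moreover have "?c (str_val s) (length s) (length s) = code_str s" for s :: str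
    using *[of "length s" "length s" "str_val s"] by simp
  ultimately show ?thesis by (simp only:)
qed

text \<open>A string is recovered from its length and value, so two number quantifiers replace one
  over strings; the inner one, entry 0, is the length.\<close>

lemma sigma1_ex_str:
  assumes "sigma1 (\<lambda>e. Q (str_of (e 0) (e (Suc 0))) (\<lambda>i. e (Suc (Suc i))))"
  shows "sigma1 (\<lambda>e. \<exists>s. Q s e)"
proof -
  have "sigma1 (\<lambda>e. \<exists>k l. Q (str_of l k) e)" by (intro sigma1_ex assms)
  moreover have "(\<exists>k l. Q (str_of l k) e) \<longleftrightarrow> (\<exists>s. Q s e)" for e
  proof
    assume "\<exists>s. Q s e"
    then obtain s where "Q (str_of (length s) (str_val s)) e" by auto
    then show "\<exists>k l. Q (str_of l k) e" by (intro exI)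
  qed (elim exE, intro exI)
  ultimately show ?thesis by simp
qed

lemma sigma1_mem_functional:
  assumes "turing_functional \<Phi>" "pr_str f" "pr_str g"
  shows "sigma1 (\<lambda>e. (f e, g e) \<in> \<Phi>)"
proof -
  have "sigma1 (\<lambda>e. prod_encode (code_str (f e), code_str (g e)) \<in> code_pair ` \<Phi>)"
    using assms by (intro sigma1_mem pr_prod_encode pr_code_str) (auto simp: turing_functional_def)
  moreover have "prod_encode (code_str s, code_str t) \<in> code_pair ` \<Phi> \<longleftrightarrow> (s, t) \<in> \<Phi>" for s t
    by (force simp: code_pair_def inj_eq[OF inj_code_str])
  ultimately show ?thesis by simp
qed

lemma sigma1_mem_test:
  assumes "ml_test W" "pr_fun t" "pr_str f"
  shows "sigma1 (\<lambda>e. (t e, f e) \<in> W)"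
proof -
  have "sigma1 (\<lambda>e. prod_encode (t e, code_str (f e)) \<in> (\<lambda>(n, s). prod_encode (n, code_str s)) ` W)"
    using assms by (intro sigma1_mem pr_prod_encode pr_code_str) (auto simp: ml_test_def)
  moreover have "prod_encode (n, code_str s) \<in> (\<lambda>(n, s). prod_encode (n, code_str s)) ` W \<longleftrightarrow> (n, s) \<in> W" for n s
    by (force simp: inj_eq[OF inj_code_str])
  ultimately show ?thesis by simp
qed

lemma ml_testI:
  assumes "sigma1 (\<lambda>e. (e 0, str_of (e (Suc 0)) (e (Suc (Suc 0)))) \<in> W)"
    and "\<And>n. measure lam (cyl {s. (n, s) \<in> W}) \<le> (1/2) ^ n"
  shows "ml_test W"
proof -
  \<comment> \<open>The level is entry 0 in the hypothesis but entry 2 below the quantifiers over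
    \<open>n\<close> and then \<open>s\<close>, so the entries are rotated.\<close>
  have "sigma1 (\<lambda>e. (\<lambda>f. (f 0, str_of (f (Suc 0)) (f (Suc (Suc 0)))) \<in> W)
      (\<lambda>i. e (if i = 0 then Suc (Suc 0) else if i = Suc 0 then 0 else Suc 0)))"
    by (rule sigma1_subst[OF assms(1)]) (rule pr_var)
  then have s: "sigma1 (\<lambda>e. (e (Suc (Suc 0)), str_of (e 0) (e (Suc 0))) \<in> W)" by simp
  have "sigma1 (\<lambda>e. \<exists>n s. (n, s) \<in> W \<and> e 0 = prod_encode (n, code_str s))"
    by (intro sigma1_ex sigma1_ex_str sigma1_conj s sigma1_dp pr_intros pr_code_str pr_str_str_of)
  moreover have "(\<exists>n s. (n, s) \<in> W \<and> x = prod_encode (n, code_str s)) \<longleftrightarrow>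
      x \<in> (\<lambda>(n, s). prod_encode (n, code_str s)) ` W" for x
    by (force simp: image_iff)
  ultimately show ?thesis using assms(2) by (simp add: ml_test_def ce_set_iff_sigma1)
qed

text \<open>Each \<open>q i + (1/2) ^ i\<close> bounds \<open>a\<close> from above, and it falls
  below \<open>r\<close> once the error is less than half of the gap. Hence strict upper bounds on a
  computable real are enumerable.\<close>

lemma less_iff_approx:
  fixes a :: real
  assumes "\<And>i. \<bar>a - q i\<bar> \<le> (1/2) ^ i"
  shows "a < r \<longleftrightarrow> (\<exists>i. q i + (1/2) ^ i < r)"
proof
  assume "a < r"
  then obtain i where i: "(1/2) ^ i < (r - a) / 2"
    using real_arch_pow_inv[of "(r - a) / 2" "1/2"] by auto
  have "q i + (1/2) ^ i < r" using assms[of i] i by (simp add: abs_le_iff field_simps)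
  then show "\<exists>i. q i + (1/2) ^ i < r" ..
next
  assume "\<exists>i. q i + (1/2) ^ i < r"
  then obtain i where "q i + (1/2) ^ i < r" ..
  then show "a < r" using assms[of i] by (simp add: abs_le_iff)
qed

text \<open>Clearing the denominators and moving the subtracted \<open>b\<close> across leaves an
  inequality between naturals, which is primitive recursive.\<close>

lemma dec_rat_less_iff:
  "dec_rat (prod_encode (a, prod_encode (b, c))) + (1/2) ^ i < real x / 2 ^ y \<longleftrightarrow>
    a * 2 ^ i * 2 ^ y + Suc c * 2 ^ y < x * Suc c * 2 ^ i + b * 2 ^ i * 2 ^ y"
proof -
  have "dec_rat (prod_encode (a, prod_encode (b, c))) + (1/2) ^ i < real x / 2 ^ y \<longleftrightarrow>
     (real a - real b) / real (Suc c) + 1 / 2 ^ i < real x / 2 ^ y"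
    by (simp add: dec_rat_def power_one_over add.commute)
  also have "\<dots> \<longleftrightarrow> (real a - real b) * 2 ^ i * 2 ^ y + real (Suc c) * 2 ^ y < real x * real (Suc c) * 2 ^ i"
    by (simp add: field_simps del: of_nat_Suc)
  also have "\<dots> \<longleftrightarrow> real (a * 2 ^ i * 2 ^ y + Suc c * 2 ^ y) < real (x * Suc c * 2 ^ i + b * 2 ^ i * 2 ^ y)"
    by (simp add: algebra_simps)
  also have "\<dots> \<longleftrightarrow> a * 2 ^ i * 2 ^ y + Suc c * 2 ^ y < x * Suc c * 2 ^ i + b * 2 ^ i * 2 ^ y"
    by (rule of_nat_less_iff)
  finally show ?thesis .
qed

text \<open>The value of the approximating function is guessed as a triple and checked against its
  enumerable graph; the remaining inequality is decidable.\<close>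

lemma sigma1_semimeasure_less:
  assumes "computable_semimeasure \<rho>" "pr_str f" "pr_fun x" "pr_fun y"
  shows "sigma1 (\<lambda>e. \<rho> (f e) < real (x e) / 2 ^ y e)"
proof -
  obtain g where g: "computable_fun g"
    "\<And>s i. \<bar>\<rho> s - dec_rat (g (prod_encode (code_str s, i)))\<bar> \<le> (1/2) ^ i"
    using assms(1) unfolding computable_semimeasure_def by blast
  let ?G = "{prod_encode (n, g n) | n. True}"
  have G: "ce_set ?G" using g(1) by (simp add: computable_fun_def)
  have graph: "prod_encode (n, v) \<in> ?G \<longleftrightarrow> v = g n" for n v by auto
  have dec: "\<exists>a b c. v = prod_encode (a, prod_encode (b, c))" for v
    by (metis prod_decode_inverse surj_pair)
  have eq: "\<rho> s < real x / 2 ^ y \<longleftrightarrow> (\<exists>i a b c.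
      prod_encode (prod_encode (code_str s, i), prod_encode (a, prod_encode (b, c))) \<in> ?G \<and>
      a * 2 ^ i * 2 ^ y + Suc c * 2 ^ y < x * Suc c * 2 ^ i + b * 2 ^ i * 2 ^ y)" for s x y
  proof -
    have "(\<exists>a b c. prod_encode (a, prod_encode (b, c)) = v \<and>
        dec_rat (prod_encode (a, prod_encode (b, c))) + (1/2) ^ i < r) \<longleftrightarrow> dec_rat v + (1/2) ^ i < r" for v i r
      using dec[of v] by auto
    then show ?thesis unfolding less_iff_approx[OF g(2)] graph dec_rat_less_iff[symmetric] by presburger
  qed
  show ?thesis unfolding eq
    by (intro sigma1_ex sigma1_conj sigma1_mem G sigma1_dp pr_intros pr_code_str pr_str_subst[OF assms(2)]
      pr_subst[OF assms(3)] pr_subst[OF assms(4)])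
qed

text \<open>The counterpart of \<open>out_ext\<close> for a finite oracle \<open>s\<close>. It
  carries no time bound, so it is enumerable and monotone in \<open>s\<close> but in general not
  decidable.\<close>

definition out_str :: "(str \<times> str) set \<Rightarrow> str \<Rightarrow> str \<Rightarrow> bool" where
  "out_str \<Phi> s \<rho> \<longleftrightarrow> \<rho> = [] \<or> (\<exists>\<sigma> \<tau>. (\<sigma>, \<tau>) \<in> \<Phi> \<and> prefix \<sigma> s \<and> prefix \<rho> \<tau>)"

lemma sigma1_out_str:
  assumes "turing_functional \<Phi>" "pr_str f" "pr_str g"
  shows "sigma1 (\<lambda>e. out_str \<Phi> (f e) (g e))"
  unfolding out_str_def
  by (intro sigma1_disj sigma1_ex_str sigma1_conj sigma1_mem_functional assms sigma1_dp pr_pred_str_eq pr_pred_prefix pr_str_const pr_str_str_of pr_var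
    pr_str_subst[OF assms(2)] pr_str_subst[OF assms(3)])

lemma sigma1_test_prefix:
  assumes "ml_test W" "pr_fun t" "pr_str f"
  shows "sigma1 (\<lambda>e. \<exists>s. (t e, s) \<in> W \<and> prefix s (f e))"
  by (intro sigma1_ex_str sigma1_conj sigma1_mem_test assms sigma1_dp pr_pred_prefix pr_str_str_of pr_var
    pr_str_subst[OF assms(3)] pr_subst[OF assms(2)])

section \<open>The uniform measure on Cantor space\<close>

abbreviation trunc :: "cantor \<Rightarrow> nat \<Rightarrow> str" where
  "trunc X L \<equiv> map X [0..<L]"

lemma init_seg_iff: "init_seg s X \<longleftrightarrow> trunc X (length s) = s"
  unfolding init_seg_def list_eq_iff_nth_eq by simp

lemma take_trunc: "take a (trunc X L) = trunc X (min a L)"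
  by (simp add: take_map min_def)

lemma prefix_trunc_iff: "prefix s (trunc X L) \<longleftrightarrow> length s \<le> L \<and> init_seg s X"
proof
  assume p: "prefix s (trunc X L)"
  then have "length s \<le> L" using prefix_length_le by fastforce
  moreover have "take (length s) (trunc X L) = s" using p by (auto simp: prefix_def)
  ultimately show "length s \<le> L \<and> init_seg s X" by (simp add: take_trunc init_seg_iff min_def)
next
  assume "length s \<le> L \<and> init_seg s X"
  then have "take (length s) (trunc X L) = s" by (simp add: take_trunc init_seg_iff min_def)
  then show "prefix s (trunc X L)" using take_is_prefix[of "length s" "trunc X L"] by simp
qed

lemma space_lam [simp]: "space lam = UNIV"
  by (simp add: lam_def space_PiM)

interpretation coin: product_prob_space "\<lambda>_::nat. measure_pmf (bernoulli_pmf (1/2))" UNIV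
  by (intro product_prob_spaceI) (rule prob_space_measure_pmf)

interpretation lam: prob_space lam
  unfolding lam_def by (rule coin.prob_space_axioms)

lemma cylinder_eq_prod_emb:
  "{X. init_seg s X} = prod_emb UNIV (\<lambda>_::nat. measure_pmf (bernoulli_pmf (1/2))) {..<length s}
     (Pi\<^sub>E {..<length s} (\<lambda>i. {s ! i}))"
  by (subst prod_emb_Pi) (auto simp: init_seg_def PiE_iff split: if_splits)

lemma sets_cylinder: "{X. init_seg s X} \<in> sets lam"
  unfolding cylinder_eq_prod_emb lam_def by (intro sets_PiM_I) auto

lemma measure_cylinder: "measure lam {X. init_seg s X} = (1/2) ^ length s"
proof -
  have "measure lam {X. init_seg s X} = (\<Prod>i<length s. measure (measure_pmf (bernoulli_pmf (1/2))) {s ! i})"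
    unfolding cylinder_eq_prod_emb lam_def by (rule coin.measure_PiM_emb) auto
  also have "\<dots> = (\<Prod>i<length s. 1/2)"
  proof (rule prod.cong)
    fix i
    show "measure (measure_pmf (bernoulli_pmf (1/2))) {s ! i} = 1/2"
      by (cases "s ! i") (auto simp: measure_pmf_single)
  qed simp
  finally show ?thesis by simp
qed

lemma Collect_trunc_eq_UN:
  "{X. P (trunc X L)} = (\<Union>s\<in>{s. length s = L \<and> P s}. {X. init_seg s X})"
  by (auto simp: init_seg_iff)

lemma finite_strs: "finite {s::str. length s = L \<and> P s}"
  by (rule finite_subset[OF _ finite_lists_length_eq[of UNIV L]]) auto

lemma sets_trunc: "{X. P (trunc X L)} \<in> sets lam"
  unfolding Collect_trunc_eq_UN by (intro sets.finite_UN finite_strs sets_cylinder)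

lemma sets_ex_trunc: "{X. \<exists>L. P L (trunc X L)} \<in> sets lam"
proof -
  have "{X. \<exists>L. P L (trunc X L)} = (\<Union>L. {X. P L (trunc X L)})" by auto
  then show ?thesis using sets_trunc by (auto intro!: sets.countable_UN)
qed

lemma card_strs: "card {s. length s = L \<and> P s} = card {v. v < 2 ^ L \<and> P (str_of L v)}"
  by (rule bij_betw_same_card[of str_val], rule bij_betw_byWitness[of _ "str_of L"])
    (auto simp: str_val_str_of str_val_less)

text \<open>The cylinders of length \<open>L\<close> are disjoint and of equal weight, which turns
  the measure of a clopen set into a count of string values.\<close>

lemma measure_trunc: "measure lam {X. P (trunc X L)} = card {v. v < 2 ^ L \<and> P (str_of L v)} / 2 ^ L"
proof -
  have "measure lam {X. P (trunc X L)} = (\<Sum>s\<in>{s. length s = L \<and> P s}. measure lam {X. init_seg s X})"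
    unfolding Collect_trunc_eq_UN
    by (rule lam.finite_measure_finite_Union[OF finite_strs])
      (auto simp: sets_cylinder disjoint_family_on_def init_seg_iff)
  also have "\<dots> = (\<Sum>s\<in>{s. length s = L \<and> P s}. (1/2) ^ L)"
    by (rule sum.cong) (auto simp: measure_cylinder)
  finally show ?thesis by (simp add: card_strs power_one_over)
qed

text \<open>By continuity from below along increasing clopen stages, a strict lower bound on the
  measure shows at a finite stage. This is what makes such bounds enumerable.\<close>

lemma less_measure_iff:
  assumes "\<And>X L. P L (trunc X L) \<Longrightarrow> P (Suc L) (trunc X (Suc L))"
  shows "r < measure lam {X. \<exists>L. P L (trunc X L)} \<longleftrightarrow>
    (\<exists>L. r < card {v. v < 2 ^ L \<and> P L (str_of L v)} / 2 ^ L)"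
proof -
  let ?A = "\<lambda>L. {X. P L (trunc X L)}"
  have eq: "{X. \<exists>L. P L (trunc X L)} = (\<Union>L. ?A L)" by auto
  have "incseq ?A" by (rule incseq_SucI) (use assms in auto)
  then have lim: "(\<lambda>L. measure lam (?A L)) \<longlonglongrightarrow> measure lam (\<Union>L. ?A L)"
    by (intro lam.finite_Lim_measure_incseq) (auto simp: sets_trunc)
  show ?thesis unfolding eq measure_trunc[symmetric]
  proof
    assume "r < measure lam (\<Union>L. ?A L)"
    from order_tendstoD(1)[OF lim this] show "\<exists>L. r < measure lam (?A L)"
      by (auto simp: eventually_sequentially)
  next
    assume "\<exists>L. r < measure lam (?A L)"
    then obtain L where L: "r < measure lam (?A L)" ..
    have "(\<Union>L. ?A L) \<in> sets lam" using sets_ex_trunc[of P] unfolding eq .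
    then have "measure lam (?A L) \<le> measure lam (\<Union>L. ?A L)"
      by (intro lam.finite_measure_mono) auto
    with L show "r < measure lam (\<Union>L. ?A L)" by simp
  qed
qed

section \<open>Open sets and outputs in terms of truncated oracles\<close>

lemma cyl_iff_trunc: "X \<in> cyl U \<longleftrightarrow> (\<exists>L. \<exists>s. s \<in> U \<and> prefix s (trunc X L))"
  unfolding cyl_def by (auto simp: prefix_trunc_iff)

lemma cyl_Collect: "cyl {s. P s} = {X. \<exists>L. P (trunc X L)}"
proof (intro set_eqI iffI)
  fix X assume "X \<in> cyl {s. P s}"
  then obtain s where "P s" "init_seg s X" by (auto simp: cyl_def)
  then show "X \<in> {X. \<exists>L. P (trunc X L)}" by (auto simp: init_seg_iff intro!: exI[of _ "length s"])
next
  fix X assume "X \<in> {X. \<exists>L. P (trunc X L)}"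
  then obtain L where "P (trunc X L)" by auto
  then show "X \<in> cyl {s. P s}" unfolding cyl_def by (auto simp: init_seg_iff intro!: exI[of _ "trunc X L"])
qed

lemma sets_cyl: "cyl U \<in> sets lam"
  using sets_ex_trunc[of "\<lambda>_ s. s \<in> U"] cyl_Collect[of "\<lambda>s. s \<in> U"] by simp

lemma out_str_mono: "out_str \<Phi> s \<rho> \<Longrightarrow> prefix s t \<Longrightarrow> out_str \<Phi> t \<rho>"
  unfolding out_str_def using prefix_order.trans by blast

lemma out_ext_iff: "out_ext \<Phi> X \<rho> \<longleftrightarrow> (\<exists>L. out_str \<Phi> (trunc X L) \<rho>)"
  unfolding out_ext_def outs_def out_str_def by (auto simp: prefix_trunc_iff)

lemma sets_out_ext: "{X. out_ext \<Phi> X \<rho>} \<in> sets lam"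
  unfolding out_ext_iff by (rule sets_ex_trunc)

lemma out_ext_prefix: "out_ext \<Phi> X \<rho> \<Longrightarrow> prefix \<rho>' \<rho> \<Longrightarrow> out_ext \<Phi> X \<rho>'"
  unfolding out_ext_def by (cases "\<rho> = []") (auto intro: prefix_order.trans)

lemma outs_comparable:
  assumes "turing_functional \<Phi>" "\<tau> \<in> outs \<Phi> X" "\<tau>' \<in> outs \<Phi> X"
  shows "prefix \<tau> \<tau>' \<or> prefix \<tau>' \<tau>"
proof -
  obtain \<sigma> \<sigma>' where s: "(\<sigma>, \<tau>) \<in> \<Phi>" "init_seg \<sigma> X" "(\<sigma>', \<tau>') \<in> \<Phi>" "init_seg \<sigma>' X"
    using assms(2,3) by (auto simp: outs_def)
  then have "prefix \<sigma> \<sigma>' \<or> prefix \<sigma>' \<sigma>"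
    using prefix_trunc_iff[of \<sigma> X "max (length \<sigma>) (length \<sigma>')"]
      prefix_trunc_iff[of \<sigma>' X "max (length \<sigma>) (length \<sigma>')"] prefix_same_cases by auto
  then show ?thesis using assms(1) s unfolding turing_functional_def by blast
qed

lemma out_ext_comparable:
  assumes "turing_functional \<Phi>" "out_ext \<Phi> X \<rho>" "out_ext \<Phi> X \<rho>'"
  shows "prefix \<rho> \<rho>' \<or> prefix \<rho>' \<rho>"
proof (cases "\<rho> = [] \<or> \<rho>' = []")
  case False
  then obtain \<tau> \<tau>' where t: "\<tau> \<in> outs \<Phi> X" "prefix \<rho> \<tau>" "\<tau>' \<in> outs \<Phi> X" "prefix \<rho>' \<tau>'"
    using assms by (auto simp: out_ext_def)
  from outs_comparable[OF assms(1) t(1,3)] show ?thesis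
    using t by (meson prefix_order.trans prefix_same_cases)
qed auto

text \<open>Removes the definite description in \<open>apply_tf\<close>: having the value
  \<open>Y\<close> becomes a countable conjunction of open conditions on \<open>X\<close>, the form
  that the measure and compactness arguments use.\<close>

lemma in_dom_tf_apply_eq_iff:
  assumes "turing_functional \<Phi>"
  shows "X \<in> dom_tf \<Phi> \<and> apply_tf \<Phi> X = Y \<longleftrightarrow> (\<forall>n. out_ext \<Phi> X (trunc Y n))"
proof
  assume X: "X \<in> dom_tf \<Phi> \<and> apply_tf \<Phi> X = Y"
  have bit: "Y i = \<tau> ! i" if "\<tau> \<in> outs \<Phi> X" "i < length \<tau>" for \<tau> i
  proof -
    have "apply_tf \<Phi> X i = \<tau> ! i" unfolding apply_tf_def
    proof (rule the_equality)
      fix b assume "\<exists>\<tau>\<in>outs \<Phi> X. i < length \<tau> \<and> \<tau> ! i = b"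
      then obtain \<tau>' where "\<tau>' \<in> outs \<Phi> X" "i < length \<tau>'" "\<tau>' ! i = b" by auto
      with outs_comparable[OF assms that(1) this(1)] that(2) show "b = \<tau> ! i"
        by (auto simp: prefix_def nth_append)
    qed (use that in auto)
    then show ?thesis using X by simp
  qed
  show "\<forall>n. out_ext \<Phi> X (trunc Y n)"
  proof
    fix n
    obtain \<tau> where t: "\<tau> \<in> outs \<Phi> X" "n < length \<tau>" using X by (auto simp: dom_tf_def)
    have "trunc Y n = take n \<tau>" by (rule nth_equalityI) (use t bit in auto)
    then show "out_ext \<Phi> X (trunc Y n)" using t(1) take_is_prefix[of n \<tau>] unfolding out_ext_def by auto
  qed
next
  assume X: "\<forall>n. out_ext \<Phi> X (trunc Y n)"
  have ex: "\<exists>\<tau>\<in>outs \<Phi> X. n < length \<tau> \<and> \<tau> ! n = Y n" for n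
  proof -
    obtain \<tau> where t: "\<tau> \<in> outs \<Phi> X" "prefix (trunc Y (Suc n)) \<tau>"
      using X[rule_format, of "Suc n"] by (auto simp: out_ext_def)
    then obtain u where "\<tau> = trunc Y (Suc n) @ u" by (auto simp: prefix_def)
    then show ?thesis using t(1) by (intro bexI[of _ \<tau>]) (auto simp: nth_append)
  qed
  have "apply_tf \<Phi> X n = Y n" for n
    unfolding apply_tf_def
  proof (rule the_equality, rule ex)
    fix b assume "\<exists>\<tau>\<in>outs \<Phi> X. n < length \<tau> \<and> \<tau> ! n = b"
    then obtain \<tau>' where "\<tau>' \<in> outs \<Phi> X" "n < length \<tau>'" "\<tau>' ! n = b" by auto
    moreover obtain \<tau> where "\<tau> \<in> outs \<Phi> X" "n < length \<tau>" "\<tau> ! n = Y n" using ex by blast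
    ultimately show "b = Y n" using outs_comparable[OF assms, of \<tau> X \<tau>'] by (auto simp: prefix_def nth_append)
  qed
  then show "X \<in> dom_tf \<Phi> \<and> apply_tf \<Phi> X = Y" using ex by (auto simp: dom_tf_def)
qed

lemma image_tf_iff:
  assumes "turing_functional \<Phi>"
  shows "Y \<in> image_tf \<Phi> A \<longleftrightarrow> (\<exists>X\<in>A. \<forall>n. out_ext \<Phi> X (trunc Y n))"
  unfolding image_tf_def in_dom_tf_apply_eq_iff[OF assms, symmetric] by auto

text \<open>Compactness as in Koenig's lemma: if infinitely many terms pass through a string,
  infinitely many pass through one of its two extensions, and following these builds
  \<open>Z\<close>.\<close>

lemma ex_cluster_point:
  fixes Zs :: "nat \<Rightarrow> cantor"
  shows "\<exists>Z. \<forall>L. infinite {n. trunc (Zs n) L = trunc Z L}"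
proof -
  have "\<exists>b. infinite {n. trunc (Zs n) (Suc L) = s @ [b]}"
    if "infinite {n. trunc (Zs n) L = s}" for L s
  proof (rule ccontr)
    assume "\<not> ?thesis"
    then have "finite ({n. trunc (Zs n) (Suc L) = s @ [False]} \<union> {n. trunc (Zs n) (Suc L) = s @ [True]})"
      unfolding finite_Un by blast
    moreover have "{n. trunc (Zs n) L = s} \<subseteq>
      {n. trunc (Zs n) (Suc L) = s @ [False]} \<union> {n. trunc (Zs n) (Suc L) = s @ [True]}" by auto
    ultimately show False using that finite_subset by blast
  qed
  then have "\<forall>L s. \<exists>b. infinite {n. trunc (Zs n) L = s} \<longrightarrow> infinite {n. trunc (Zs n) (Suc L) = s @ [b]}"
    by blast
  then obtain ext where ext: "infinite {n. trunc (Zs n) L = s} \<Longrightarrow>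
      infinite {n. trunc (Zs n) (Suc L) = s @ [ext L s]}" for L s
    unfolding choice_iff by blast
  define S where "S = rec_nat [] (\<lambda>L s. s @ [ext L s])"
  have S_simps: "S 0 = []" "S (Suc L) = S L @ [ext L (S L)]" for L by (auto simp: S_def)
  have inf: "infinite {n. trunc (Zs n) L = S L}" for L
    by (induction L) (use ext S_simps in auto)
  define Z where "Z = (\<lambda>L. ext L (S L))"
  have "trunc Z L = S L" for L by (induction L) (auto simp: S_simps Z_def)
  then show ?thesis using inf by (intro exI[of _ Z]) auto
qed

section \<open>Countability of the tests\<close>

text \<open>Terms denoting primitive recursive functions. Arities are not recorded, since for
  countability it is enough that every such function has a term.\<close>

datatype prc = Zero | Succ | Proj nat | Comp prc "prc list" | Rec prc prc

instance prc :: countable by countable_datatype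

primrec prc_eval :: "prc \<Rightarrow> nat list \<Rightarrow> nat" where
  "prc_eval Zero = (\<lambda>_. 0)"
| "prc_eval Succ = (\<lambda>xs. Suc (hd xs))"
| "prc_eval (Proj i) = (\<lambda>xs. xs ! i)"
| "prc_eval (Comp g fs) = (\<lambda>xs. prc_eval g (map (\<lambda>f. f xs) (map prc_eval fs)))"
| "prc_eval (Rec g h) = (\<lambda>xs. rec_nat (prc_eval g (tl xs)) (\<lambda>k r. prc_eval h (k # r # tl xs)) (hd xs))"

lemma prim_rec_imp_prc_eval: "prim_rec n f \<Longrightarrow> f \<in> range prc_eval"
proof (induction rule: prim_rec.induct)
  case (pr_zero n)
  then show ?case by (intro range_eqI[of _ _ Zero]) simp
next
  case pr_succ
  then show ?case by (intro range_eqI[of _ _ Succ]) simp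
next
  case (pr_proj i n)
  then show ?case by (intro range_eqI[of _ _ "Proj i"]) simp
next
  case (pr_comp m g fs n)
  obtain c where c: "g = prc_eval c" using pr_comp.IH(1) by auto
  have "\<forall>f\<in>set fs. f \<in> range prc_eval" using pr_comp.IH(2) pr_comp.hyps(2) by (auto simp: in_set_conv_nth)
  then have "fs = map prc_eval (map (inv prc_eval) fs)" by (induction fs) (auto simp: f_inv_into_f)
  then have "(\<lambda>xs. g (map (\<lambda>f. f xs) fs)) = prc_eval (Comp c (map (inv prc_eval) fs))" using c by simp
  then show ?case by blast
next
  case (pr_rec n g h)
  then obtain c d where "g = prc_eval c" "h = prc_eval d" by blast
  then have "(\<lambda>xs. rec_nat (g (tl xs)) (\<lambda>k r. h (k # r # tl xs)) (hd xs)) = prc_eval (Rec c d)" by simp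
  then show ?case by blast
qed

lemma countable_ce_sets: "countable {A. ce_set A}"
proof -
  have "{A. ce_set A} \<subseteq> (\<lambda>c. {n. \<exists>m. prc_eval c [n, m] = 0}) ` UNIV"
  proof
    fix A assume "A \<in> {A. ce_set A}"
    then obtain f where f: "prim_rec 2 f" "\<forall>n. n \<in> A \<longleftrightarrow> (\<exists>m. f [n, m] = 0)" by (auto simp: ce_set_def)
    obtain c where "f = prc_eval c" using prim_rec_imp_prc_eval[OF f(1)] by auto
    then have "A = {n. \<exists>m. prc_eval c [n, m] = 0}" using f(2) by auto
    then show "A \<in> (\<lambda>c. {n. \<exists>m. prc_eval c [n, m] = 0}) ` UNIV" by blast
  qed
  then show ?thesis by (rule countable_subset) simp
qed

lemma countable_ml_tests: "countable {W. ml_test W}"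
proof -
  let ?c = "\<lambda>(n, s). prod_encode (n, code_str s)"
  have "inj ?c" by (auto simp: inj_on_def inj_eq[OF inj_code_str])
  then have "inj_on ((`) ?c) {W. ml_test W}" by (auto simp: inj_on_def inj_image_eq_iff)
  moreover have "(`) ?c ` {W. ml_test W} \<subseteq> {A. ce_set A}" by (auto simp: ml_test_def)
  then have "countable ((`) ?c ` {W. ml_test W})" using countable_ce_sets by (rule countable_subset)
  ultimately show ?thesis by (rule countable_image_inj_on[rotated])
qed

section \<open>Transfer of tests along equal induced semi-measures\<close>

text \<open>Passing to the prefix-minimal elements of the index set makes the families of preimages
  disjoint, for both functionals.\<close>

lemma measure_out_ext_le:
  assumes "turing_functional \<Phi>" "turing_functional \<Psi>" "B \<in> sets lam"
    and le: "\<And>\<sigma>. \<sigma> \<in> A \<Longrightarrow> induced \<Phi> \<sigma> \<le> c * measure lam ({Z. out_ext \<Psi> Z \<sigma>} \<inter> B)" and "0 \<le> c"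
  shows "measure lam {X. \<exists>\<sigma>\<in>A. out_ext \<Phi> X \<sigma>} \<le> c * measure lam B"
proof -
  define A' where "A' = {\<sigma>\<in>A. \<forall>\<tau>\<in>A. prefix \<tau> \<sigma> \<longrightarrow> \<tau> = \<sigma>}"
  have A': "\<exists>\<tau>\<in>A'. prefix \<tau> \<sigma>" if "\<sigma> \<in> A" for \<sigma>
    using that
  proof (induction "length \<sigma>" arbitrary: \<sigma> rule: less_induct)
    case less
    show ?case
    proof (cases "\<sigma> \<in> A'")
      case False
      then obtain \<tau> where t: "\<tau> \<in> A" "prefix \<tau> \<sigma>" "\<tau> \<noteq> \<sigma>" using less.prems by (auto simp: A'_def)
      then have "length \<tau> < length \<sigma>" by (simp add: prefix_length_less strict_prefixI)
      from less.hyps[OF this t(1)] show ?thesis using t(2) prefix_order.trans by blast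
    qed auto
  qed
  have disj: "\<sigma> = \<sigma>'" if "\<sigma> \<in> A'" "\<sigma>' \<in> A'" "out_ext \<Xi> X \<sigma>" "out_ext \<Xi> X \<sigma>'" "turing_functional \<Xi>" for \<sigma> \<sigma>' X \<Xi>
    using out_ext_comparable[OF that(5,3,4)] that(1,2) unfolding A'_def by blast
  \<comment> \<open>Indexing by codes gives sequences over all naturals, with empty sets at numbers
    that code no element of \<open>A'\<close>.\<close>
  define G where "G n = {X. \<exists>\<sigma>\<in>A'. code_str \<sigma> = n \<and> out_ext \<Phi> X \<sigma>}" for n
  define H where "H n = {Z. \<exists>\<sigma>\<in>A'. code_str \<sigma> = n \<and> out_ext \<Psi> Z \<sigma>} \<inter> B" for n
  have code_out: "{X. \<exists>\<sigma>\<in>A'. code_str \<sigma> = code_str \<sigma>' \<and> out_ext \<Xi> X \<sigma>} = {X. out_ext \<Xi> X \<sigma>'}"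
    if "\<sigma>' \<in> A'" for \<sigma>' \<Xi>
    using that injD[OF inj_code_str] by blast
  have GH: "G n \<in> sets lam \<and> H n \<in> sets lam \<and> measure lam (G n) \<le> c * measure lam (H n)" for n
  proof (cases "\<exists>\<sigma>\<in>A'. code_str \<sigma> = n")
    case True
    then obtain \<sigma> where s: "\<sigma> \<in> A'" "code_str \<sigma> = n" by auto
    have "G n = {X. out_ext \<Phi> X \<sigma>}" "H n = {Z. out_ext \<Psi> Z \<sigma>} \<inter> B"
      unfolding G_def H_def s(2)[symmetric] code_out[OF s(1)] by simp_all
    moreover have "\<sigma> \<in> A" using s(1) by (simp add: A'_def)
    ultimately show ?thesis using le[of \<sigma>] assms(3) by (simp add: induced_def sets_out_ext sets.Int)
  next
    case False
    then have "G n = {}" "H n = {}" by (auto simp: G_def H_def)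
    then show ?thesis by simp
  qed
  have *: "{X. \<exists>\<sigma>\<in>A'. code_str \<sigma> = m \<and> out_ext \<Xi> X \<sigma>} \<inter> {X. \<exists>\<sigma>\<in>A'. code_str \<sigma> = n \<and> out_ext \<Xi> X \<sigma>} = {}"
    if "turing_functional \<Xi>" "m \<noteq> n" for \<Xi> m n
  proof (intro equals0I)
    fix X assume "X \<in> {X. \<exists>\<sigma>\<in>A'. code_str \<sigma> = m \<and> out_ext \<Xi> X \<sigma>} \<inter> {X. \<exists>\<sigma>\<in>A'. code_str \<sigma> = n \<and> out_ext \<Xi> X \<sigma>}"
    then obtain \<sigma> \<sigma>' where "\<sigma> \<in> A'" "\<sigma>' \<in> A'" "out_ext \<Xi> X \<sigma>" "out_ext \<Xi> X \<sigma>'"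
      and mn: "code_str \<sigma> = m" "code_str \<sigma>' = n" by blast
    then have "\<sigma> = \<sigma>'" using disj that(1) by blast
    then show False using mn that(2) by simp
  qed
  have "disjoint_family G" "disjoint_family H"
    unfolding disjoint_family_on_def G_def H_def using *[OF assms(1)] *[OF assms(2)] by blast+
  then have sums_G: "(\<lambda>n. measure lam (G n)) sums measure lam (\<Union>n. G n)"
    and sums_H: "(\<lambda>n. measure lam (H n)) sums measure lam (\<Union>n. H n)"
    using GH by (auto intro!: lam.finite_measure_UNION)
  have "measure lam (\<Union>n. G n) \<le> c * measure lam (\<Union>n. H n)"
    by (rule sums_le[OF _ sums_G sums_mult[OF sums_H]]) (use GH in blast)
  also have "\<dots> \<le> c * measure lam B"
    using assms(3,5) by (intro mult_left_mono lam.finite_measure_mono) (auto simp: H_def)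
  finally have "measure lam (\<Union>n. G n) \<le> c * measure lam B" .
  moreover have "{X. \<exists>\<sigma>\<in>A. out_ext \<Phi> X \<sigma>} = (\<Union>n. G n)"
  proof (intro set_eqI iffI)
    fix X assume "X \<in> {X. \<exists>\<sigma>\<in>A. out_ext \<Phi> X \<sigma>}"
    then obtain \<sigma> where s: "\<sigma> \<in> A" "out_ext \<Phi> X \<sigma>" by auto
    then obtain \<tau> where "\<tau> \<in> A'" "prefix \<tau> \<sigma>" using A' by blast
    then show "X \<in> (\<Union>n. G n)" using out_ext_prefix[OF s(2)] by (auto simp: G_def)
  qed (auto simp: G_def A'_def)
  ultimately show ?thesis by simp
qed

text \<open>The oracles sent above bad strings have measure at most \<open>2 ^ (i + k)\<close> times
  that of component \<open>2 * (i + k)\<close> of \<open>T\<close>; the doubled index pays for the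
  factor. The offset \<open>k\<close> makes the exponent \<open>i + k\<close> at which a random
  oracle escapes as large as desired. Enumerability combines upper bounds on the semi-measure with
  lower bounds on the measure of an open set.\<close>

lemma ml_test_transfer:
  assumes "turing_functional \<Phi>" "turing_functional \<Psi>" "induced \<Phi> = induced \<Psi>"
    and "computable_semimeasure (induced \<Psi>)" "ml_test T"
  shows "ml_test {(i, s). \<exists>\<sigma>. out_str \<Phi> s \<sigma> \<and> induced \<Psi> \<sigma> <
      2 ^ (i + k) * measure lam ({Z. out_ext \<Psi> Z \<sigma>} \<inter> cyl {\<beta>. (2 * (i + k), \<beta>) \<in> T})}"
    (is "ml_test ?S")
proof (rule ml_testI)
  define P where "P i \<sigma> s \<longleftrightarrow> out_str \<Psi> s \<sigma> \<and> (\<exists>\<beta>. (2 * (i + k), \<beta>) \<in> T \<and> prefix \<beta> s)" for i \<sigma> s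
  have mono: "P i \<sigma> s \<Longrightarrow> prefix s t \<Longrightarrow> P i \<sigma> t" for i \<sigma> s t
    unfolding P_def using out_str_mono prefix_order.trans by blast
  have set_eq: "{Z. out_ext \<Psi> Z \<sigma>} \<inter> cyl {\<beta>. (2 * (i + k), \<beta>) \<in> T} = {Z. \<exists>L. P i \<sigma> (trunc Z L)}" for i \<sigma>
  proof (intro set_eqI iffI)
    fix Z assume "Z \<in> {Z. out_ext \<Psi> Z \<sigma>} \<inter> cyl {\<beta>. (2 * (i + k), \<beta>) \<in> T}"
    then obtain L \<beta> where L: "out_str \<Psi> (trunc Z L) \<sigma>" "(2 * (i + k), \<beta>) \<in> T" "init_seg \<beta> Z"
      by (auto simp: out_ext_iff cyl_def)
    have "prefix (trunc Z L) (trunc Z (max L (length \<beta>)))"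
      by (simp add: prefix_trunc_iff init_seg_iff)
    then have "out_str \<Psi> (trunc Z (max L (length \<beta>))) \<sigma>" using L(1) out_str_mono by blast
    moreover have "prefix \<beta> (trunc Z (max L (length \<beta>)))" using L(3) by (simp add: prefix_trunc_iff)
    ultimately show "Z \<in> {Z. \<exists>L. P i \<sigma> (trunc Z L)}" using L(2) unfolding P_def by blast
  next
    fix Z assume "Z \<in> {Z. \<exists>L. P i \<sigma> (trunc Z L)}"
    then show "Z \<in> {Z. out_ext \<Psi> Z \<sigma>} \<inter> cyl {\<beta>. (2 * (i + k), \<beta>) \<in> T}"
      unfolding P_def by (auto simp: out_ext_iff cyl_iff_trunc)
  qed
  \<comment> \<open>Only lower bounds on the cardinality of an enumerable set of values can be
    enumerated, so such a bound \<open>w\<close> is guessed; a smaller \<open>w\<close> only makes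
    the inequality harder.\<close>
  have iff: "induced \<Psi> \<sigma> < 2 ^ (i + k) * measure lam ({Z. out_ext \<Psi> Z \<sigma>} \<inter> cyl {\<beta>. (2 * (i + k), \<beta>) \<in> T}) \<longleftrightarrow>
     (\<exists>L w. w \<le> card {v. v < 2 ^ L \<and> P i \<sigma> (str_of L v)} \<and> induced \<Psi> \<sigma> < real (w * 2 ^ (i + k)) / 2 ^ L)"
    (is "?l \<longleftrightarrow> ?r") for i \<sigma>
  proof -
    have "?l \<longleftrightarrow> induced \<Psi> \<sigma> / 2 ^ (i + k) < measure lam {Z. \<exists>L. P i \<sigma> (trunc Z L)}"
      unfolding set_eq by (simp add: divide_less_eq mult.commute)
    also have "\<dots> \<longleftrightarrow> (\<exists>L. induced \<Psi> \<sigma> / 2 ^ (i + k) < card {v. v < 2 ^ L \<and> P i \<sigma> (str_of L v)} / 2 ^ L)"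
      by (rule less_measure_iff, erule mono) (simp add: prefix_trunc_iff init_seg_iff del: upt_Suc)
    also have "\<dots> \<longleftrightarrow> (\<exists>L. induced \<Psi> \<sigma> < real (card {v. v < 2 ^ L \<and> P i \<sigma> (str_of L v)} * 2 ^ (i + k)) / 2 ^ L)"
      by (simp add: divide_less_eq)
    also have "\<dots> \<longleftrightarrow> ?r"
    proof
      assume ?r
      then obtain L w where w: "w \<le> card {v. v < 2 ^ L \<and> P i \<sigma> (str_of L v)}"
        "induced \<Psi> \<sigma> < real (w * 2 ^ (i + k)) / 2 ^ L" by blast
      have "real (w * 2 ^ (i + k)) / 2 ^ L \<le> real (card {v. v < 2 ^ L \<and> P i \<sigma> (str_of L v)} * 2 ^ (i + k)) / 2 ^ L"
        using w(1) by (intro divide_right_mono of_nat_mono mult_le_mono) auto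
      then show "\<exists>L. induced \<Psi> \<sigma> < real (card {v. v < 2 ^ L \<and> P i \<sigma> (str_of L v)} * 2 ^ (i + k)) / 2 ^ L"
        using w(2) order_less_le_trans by blast
    qed blast
    finally show ?thesis .
  qed
  have sgP: "sigma1 (\<lambda>e. P (t e) (f e) (g e))" if "pr_fun t" "pr_str f" "pr_str g" for t f g
    unfolding P_def using that assms by (intro sigma1_conj sigma1_out_str sigma1_test_prefix pr_intros)
  show "sigma1 (\<lambda>e. (e 0, str_of (e (Suc 0)) (e (Suc (Suc 0)))) \<in> ?S)"
    unfolding mem_Collect_eq prod.case iff
    by (intro sigma1_ex_str sigma1_conj sigma1_out_str assms sigma1_ex sigma1_le_card sgP sigma1_semimeasure_less pr_str_str_of pr_intros)
next
  fix i
  let ?T = "cyl {\<beta>. (2 * (i + k), \<beta>) \<in> T}"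
  let ?A = "{\<sigma>. induced \<Psi> \<sigma> < 2 ^ (i + k) * measure lam ({Z. out_ext \<Psi> Z \<sigma>} \<inter> ?T)}"
  have "cyl {s. (i, s) \<in> ?S} = {X. \<exists>\<sigma>\<in>?A. out_ext \<Phi> X \<sigma>}"
    unfolding cyl_Collect by (auto simp: out_ext_iff)
  then have "measure lam (cyl {s. (i, s) \<in> ?S}) = measure lam {X. \<exists>\<sigma>\<in>?A. out_ext \<Phi> X \<sigma>}"
    by (simp only:)
  also have "\<dots> \<le> 2 ^ (i + k) * measure lam ?T"
    using assms(1-3) by (intro measure_out_ext_le[where \<Psi> = \<Psi>]) (auto simp: sets_cyl)
  also have "\<dots> \<le> 2 ^ (i + k) * (1/2) ^ (2 * (i + k))"
    using assms(5) unfolding ml_test_def by (intro mult_left_mono) auto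
  also have "\<dots> = (1/2) ^ (i + k)"
    unfolding mult_2 by (subst power_add) (simp add: power_one_over)
  also have "\<dots> \<le> (1/2) ^ i" by (rule power_decreasing) auto
  finally show "measure lam (cyl {s. (i, s) \<in> ?S}) \<le> (1/2) ^ i" .
qed

section \<open>Clopen approximations from inside\<close>

text \<open>Decidable clopen stages growing to the open set of oracles whose output extends
  \<open>\<sigma>\<close>. Stage \<open>M\<close> depends only on the first \<open>M\<close> bits,
  so it may be evaluated on any longer truncation.\<close>

definition clopen_stages :: "(str \<times> str) set \<Rightarrow> (nat \<Rightarrow> str \<Rightarrow> str \<Rightarrow> bool) \<Rightarrow> bool" where
  "clopen_stages \<Psi> C \<longleftrightarrow>
    (\<forall>t f g. pr_fun t \<longrightarrow> pr_str f \<longrightarrow> pr_str g \<longrightarrow> pr_pred (\<lambda>e. C (t e) (f e) (g e))) \<and>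
    (\<forall>M L X \<sigma>. M \<le> L \<longrightarrow> C M (trunc X L) \<sigma> = C M (trunc X M) \<sigma>) \<and>
    (\<forall>M X \<sigma>. C M (trunc X M) \<sigma> \<longrightarrow> C (Suc M) (trunc X (Suc M)) \<sigma>) \<and>
    (\<forall>X \<sigma>. out_ext \<Psi> X \<sigma> \<longleftrightarrow> (\<exists>M. C M (trunc X M) \<sigma>))"

lemma ex_clopen_stages:
  assumes "turing_functional \<Psi>"
  shows "\<exists>C. clopen_stages \<Psi> C"
proof -
  have "sigma1 (\<lambda>e. out_str \<Psi> (str_of (e 0) (e 1)) (str_of (e 2) (e 3)))"
    by (intro sigma1_out_str assms pr_str_str_of pr_var)
  then obtain R where R: "pr_matrix R" "\<And>e. out_str \<Psi> (str_of (e 0) (e 1)) (str_of (e 2) (e 3)) \<longleftrightarrow> (\<exists>m. R m e)"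
    using sigma1E by blast
  \<comment> \<open>The matrix may read entries beyond the four in use; the last value is repeated
    there, as the equivalence for \<open>R\<close> holds in every environment.\<close>
  define env :: "str \<Rightarrow> str \<Rightarrow> nat \<Rightarrow> nat" where
    "env s \<sigma> i = (if i = 0 then length s else if i = 1 then str_val s else if i = 2 then length \<sigma> else str_val \<sigma>)" for s \<sigma> i
  define Q where "Q m s \<sigma> = R m (env s \<sigma>)" for m s \<sigma>
  have Q: "out_str \<Psi> s \<sigma> \<longleftrightarrow> (\<exists>m. Q m s \<sigma>)" for s \<sigma>
    using R(2)[of "env s \<sigma>"] by (simp add: Q_def env_def)
  have dpQ: "pr_pred (\<lambda>e. Q (t e) (f e) (g e))" if "pr_fun t" "pr_str f" "pr_str g" for t f g
    unfolding Q_def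
  proof (rule pr_pred_subst2[OF R(1), of t "\<lambda>i e. env (f e) (g e) i"])
    show "pr_fun (\<lambda>e. env (f e) (g e) i)" for i
      using that unfolding pr_str_def env_def by (cases "i = 0"; cases "i = 1"; cases "i = 2") simp_all
  qed (rule that)
  \<comment> \<open>Stage \<open>M\<close> bounds both the witness and the length of the oracle
    prefix. Trying all prefixes, not just the longest, makes the stages increase.\<close>
  define C where "C M s \<sigma> \<longleftrightarrow> (\<exists>m<Suc M. \<exists>a<Suc M. Q m (take a s) \<sigma>)" for M s \<sigma>
  have "clopen_stages \<Psi> C" unfolding clopen_stages_def
  proof (intro conjI allI impI)
    show "pr_pred (\<lambda>e. C (t e) (f e) (g e))" if "pr_fun t" "pr_str f" "pr_str g" for t f g
      unfolding C_def
      by (intro pr_pred_bex dpQ pr_str_take pr_intros that pr_str_subst[OF that(2)] pr_str_subst[OF that(3)] pr_subst[OF that(1)])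
    have take: "take a (trunc X L) = trunc X a" if "a \<le> L" for a X L
      using that by (simp add: take_trunc min_def)
    show 2: "C M (trunc X L) \<sigma> \<longleftrightarrow> C M (trunc X M) \<sigma>" if "M \<le> L" for M L X \<sigma>
      unfolding C_def using that by (intro ex_cong conj_cong refl) (simp add: take del: upt_Suc)
    show "C (Suc M) (trunc X (Suc M)) \<sigma>" if "C M (trunc X M) \<sigma>" for M X \<sigma>
    proof -
      have "C M (trunc X (Suc M)) \<sigma>" using 2[of M "Suc M"] that by simp
      then show ?thesis unfolding C_def using less_SucI by blast
    qed
    show "out_ext \<Psi> X \<sigma> \<longleftrightarrow> (\<exists>M. C M (trunc X M) \<sigma>)" for X \<sigma>
    proof
      assume "out_ext \<Psi> X \<sigma>"
      then obtain L m where m: "Q m (trunc X L) \<sigma>" unfolding out_ext_iff Q by blast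
      then have "Q m (take L (trunc X (max m L))) \<sigma>" by (simp add: take)
      moreover have "m < Suc (max m L)" "L < Suc (max m L)" by auto
      ultimately have "C (max m L) (trunc X (max m L)) \<sigma>" unfolding C_def by blast
      then show "\<exists>M. C M (trunc X M) \<sigma>" ..
    next
      assume "\<exists>M. C M (trunc X M) \<sigma>"
      then obtain M m a where "a < Suc M" "Q m (take a (trunc X M)) \<sigma>" unfolding C_def by blast
      then have "Q m (trunc X a) \<sigma>" by (simp add: take)
      then show "out_ext \<Psi> X \<sigma>" unfolding out_ext_iff Q by blast
    qed
  qed
  then show ?thesis by blast
qed

text \<open>No stage has to be selected computably: all good stages may contribute, because later ones give
  smaller sets and so the least good stage bounds the measure.\<close>

lemma ml_test_late_outputs:
  assumes "turing_functional \<Psi>" "computable_semimeasure (induced \<Psi>)"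
    and "clopen_stages \<Psi> C"
  shows "ml_test {(i, s). \<exists>\<sigma> M.
      induced \<Psi> \<sigma> < card {v. v < 2 ^ M \<and> C M (str_of M v) \<sigma>} / 2 ^ M + (1/2) ^ (i + 1 + code_str \<sigma>) \<and>
      M \<le> length s \<and> out_str \<Psi> s \<sigma> \<and> \<not> C M s \<sigma>}"
    (is "ml_test ?S")
proof (rule ml_testI)
  have dpC: "\<And>t f g. pr_fun t \<Longrightarrow> pr_str f \<Longrightarrow> pr_str g \<Longrightarrow> pr_pred (\<lambda>e. C (t e) (f e) (g e))"
    using assms(3) unfolding clopen_stages_def by blast
  \<comment> \<open>Both terms are put over one power of 2, the form of upper bound already known to
    be enumerable.\<close>
  have iff: "r < real c / 2 ^ M + (1/2) ^ q \<longleftrightarrow> r < real (c * 2 ^ q + 2 ^ M) / 2 ^ (M + q)" for r c M q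
    by (simp add: power_add power_one_over field_simps)
  show "sigma1 (\<lambda>e. (e 0, str_of (e (Suc 0)) (e (Suc (Suc 0)))) \<in> ?S)"
    unfolding mem_Collect_eq prod.case iff length_str_of
    by (intro sigma1_ex_str sigma1_ex sigma1_conj sigma1_out_str assms(1,2) sigma1_semimeasure_less sigma1_dp dpC
      pr_code_str pr_str_str_of pr_intros)
next
  have C_trunc: "\<And>M L X \<sigma>. M \<le> L \<Longrightarrow> C M (trunc X L) \<sigma> = C M (trunc X M) \<sigma>"
    and C_Suc: "\<And>M X \<sigma>. C M (trunc X M) \<sigma> \<Longrightarrow> C (Suc M) (trunc X (Suc M)) \<sigma>"
    and C_out: "\<And>X \<sigma>. out_ext \<Psi> X \<sigma> \<longleftrightarrow> (\<exists>M. C M (trunc X M) \<sigma>)"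
    using assms(3) unfolding clopen_stages_def by blast+
  fix i
  define good where "good \<sigma> M \<longleftrightarrow>
    induced \<Psi> \<sigma> < card {v. v < 2 ^ M \<and> C M (str_of M v) \<sigma>} / 2 ^ M + (1/2) ^ (i + 1 + code_str \<sigma>)" for \<sigma> M
  \<comment> \<open>\<open>D n\<close> is the share of the string with code \<open>n\<close>; its
    bound \<open>(1/2) ^ (i + 1 + n)\<close> makes all shares sum to at most
    \<open>(1/2) ^ i\<close>.\<close>
  define D where "D n = {X. \<exists>L \<sigma> M. code_str \<sigma> = n \<and> good \<sigma> M \<and> M \<le> L \<and>
    out_str \<Psi> (trunc X L) \<sigma> \<and> \<not> C M (trunc X L) \<sigma>}" for n
  have C_mono: "C M' (trunc X M') \<sigma>" if "C M (trunc X M) \<sigma>" "M \<le> M'" for M M' X \<sigma>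
    using that(2,1) by (induction rule: dec_induct) (auto intro: C_Suc simp del: upt_Suc)
  have sets_D: "D n \<in> sets lam" for n
    using sets_ex_trunc[of "\<lambda>L s. \<exists>\<sigma> M. code_str \<sigma> = n \<and> good \<sigma> M \<and> M \<le> L \<and>
      out_str \<Psi> s \<sigma> \<and> \<not> C M s \<sigma>"] unfolding D_def .
  have measure_D: "measure lam (D n) \<le> (1/2) ^ (i + 1 + n)" for n
  proof (cases "\<exists>\<sigma> M. code_str \<sigma> = n \<and> good \<sigma> M")
    case True
    then obtain \<sigma> where s: "code_str \<sigma> = n" "\<exists>M. good \<sigma> M" by blast
    define M0 where "M0 = (LEAST M. good \<sigma> M)"
    have M0: "good \<sigma> M0" "\<And>M. good \<sigma> M \<Longrightarrow> M0 \<le> M"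
      unfolding M0_def using s(2) by (auto intro: LeastI_ex Least_le)
    let ?C = "{X. C M0 (trunc X M0) \<sigma>}"
    \<comment> \<open>A good stage is never before \<open>M0\<close> and so contains the set of
      stage \<open>M0\<close>; an oracle missing the former misses the latter.\<close>
    have "D n \<subseteq> {X. out_ext \<Psi> X \<sigma>} - ?C"
    proof
      fix X assume "X \<in> D n"
      then obtain L M where "good \<sigma> M" "M \<le> L" "out_str \<Psi> (trunc X L) \<sigma>" "\<not> C M (trunc X L) \<sigma>"
        unfolding D_def s(1)[symmetric] inj_eq[OF inj_code_str] by blast
      then show "X \<in> {X. out_ext \<Psi> X \<sigma>} - ?C"
        using C_mono[of M0 X \<sigma> M] M0(2)[of M] C_trunc[of M L X \<sigma>] by (auto simp: out_ext_iff)
    qed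
    then have "measure lam (D n) \<le> measure lam ({X. out_ext \<Psi> X \<sigma>} - ?C)"
      using sets_trunc[of "\<lambda>s. C M0 s \<sigma>" M0] by (intro lam.finite_measure_mono sets.Diff sets_out_ext)
    also have "\<dots> = induced \<Psi> \<sigma> - measure lam ?C"
      unfolding induced_def using C_out
      by (intro lam.finite_measure_Diff sets_out_ext) (auto simp: sets_trunc[of "\<lambda>s. C M0 s \<sigma>"])
    also have "\<dots> \<le> (1/2) ^ (i + 1 + n)"
      using M0(1) measure_trunc[of "\<lambda>s. C M0 s \<sigma>" M0] unfolding good_def s(1) by simp
    finally show ?thesis .
  next
    case False
    then have "D n = {}" unfolding D_def by blast
    then show ?thesis by simp
  qed
  have geo: "(\<lambda>n. (1/2) ^ (i + 1 + n)) sums ((1/2) ^ i :: real)"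
  proof -
    have "(\<lambda>n. (1/2) ^ (i + 1) * (1/2) ^ n) sums ((1/2) ^ (i + 1) * (1 / (1 - 1/2)) :: real)"
      by (intro sums_mult geometric_sums) simp
    then show ?thesis by (simp add: power_add)
  qed
  have summable: "summable (\<lambda>n. measure lam (D n))"
    by (rule summable_comparison_test'[OF sums_summable[OF geo]]) (use measure_D in simp)
  have "cyl {s. (i, s) \<in> ?S} = (\<Union>n. D n)"
    unfolding cyl_Collect D_def good_def by auto
  moreover have "measure lam (\<Union>n. D n) \<le> (\<Sum>n. measure lam (D n))"
    by (rule lam.finite_measure_subadditive_countably[OF _ summable]) (use sets_D in blast)
  moreover have "(\<Sum>n. measure lam (D n)) \<le> (1/2) ^ i"
    unfolding sums_unique[OF geo] by (rule suminf_le[OF measure_D summable sums_summable[OF geo]])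
  ultimately show "measure lam (cyl {s. (i, s) \<in> ?S}) \<le> (1/2) ^ i" by simp
qed

section \<open>Existence of a random preimage\<close>

text \<open>Were this measure 0, the open set of oracles producing \<open>\<sigma>\<close>, repeated
  at every level, would be a test capturing \<open>X\<close>.\<close>

lemma induced_pos:
  assumes "turing_functional \<Phi>" "X \<in> MLR" "out_ext \<Phi> X \<sigma>"
  shows "0 < induced \<Phi> \<sigma>"
proof (rule ccontr)
  assume "\<not> 0 < induced \<Phi> \<sigma>"
  then have 0: "measure lam {X. out_ext \<Phi> X \<sigma>} = 0"
    unfolding induced_def by (simp add: not_less measure_le_0_iff)
  let ?W = "{(n::nat, s). out_str \<Phi> s \<sigma>}"
  have cyl: "cyl {s. (n, s) \<in> ?W} = {X. out_ext \<Phi> X \<sigma>}" for n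
    unfolding cyl_Collect by (auto simp: out_ext_iff)
  have "sigma1 (\<lambda>e. (e 0, str_of (e (Suc 0)) (e (Suc (Suc 0)))) \<in> ?W)"
    unfolding mem_Collect_eq prod.case by (intro sigma1_out_str assms pr_str_str_of pr_str_const pr_var)
  then have "ml_test ?W" by (rule ml_testI) (simp only: cyl 0, simp)
  then have "\<not> (\<forall>n. X \<in> cyl {s. (n, s) \<in> ?W})" using assms(2) unfolding MLR_def by blast
  then show False unfolding cyl using assms(3) by blast
qed

text \<open>One inclusion suffices: as the induced semi-measures agree, the assumptions are
  symmetric in the two functionals.\<close>

lemma image_tf_MLR_subset:
  assumes "turing_functional \<Phi>" "turing_functional \<Psi>" "induced \<Phi> = induced \<Psi>"
    and "computable_semimeasure (induced \<Psi>)"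
  shows "image_tf \<Phi> MLR \<subseteq> image_tf \<Psi> MLR"
proof
  fix Y assume "Y \<in> image_tf \<Phi> MLR"
  then obtain X where X: "X \<in> MLR" "\<And>n. out_ext \<Phi> X (trunc Y n)"
    unfolding image_tf_iff[OF assms(1)] by blast
  let ?O = "\<lambda>n. {Z. out_ext \<Psi> Z (trunc Y n)}"
  have pos: "0 < measure lam (?O n)" for n
    using induced_pos[OF assms(1) X] unfolding assms(3) by (simp only: induced_def)
  \<comment> \<open>Escaping the transferred test at one level \<open>i\<close> settles all
    \<open>n\<close> at once with \<open>p = i + k\<close>, because on \<open>X\<close> the
    functional \<open>\<Phi>\<close> outputs every initial segment of \<open>Y\<close>.\<close>
  have small: "\<exists>p\<ge>k. \<forall>n. measure lam (?O n \<inter> cyl {s. (2 * p, s) \<in> T}) \<le> (1/2) ^ p * measure lam (?O n)"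
    if "ml_test T" for T k
  proof -
    let ?bad = "\<lambda>i s. \<exists>\<sigma>. out_str \<Phi> s \<sigma> \<and> induced \<Psi> \<sigma> <
        2 ^ (i + k) * measure lam ({Z. out_ext \<Psi> Z \<sigma>} \<inter> cyl {\<beta>. (2 * (i + k), \<beta>) \<in> T})"
    have "\<not> (\<forall>i. X \<in> cyl {s. (i, s) \<in> {(i, s). ?bad i s}})"
      using ml_test_transfer[OF assms that, of k] X(1) unfolding MLR_def by blast
    then obtain i where i: "X \<notin> cyl {s. ?bad i s}" by auto
    have "measure lam (?O n \<inter> cyl {s. (2 * (i + k), s) \<in> T}) \<le> (1/2) ^ (i + k) * measure lam (?O n)" for n
    proof -
      obtain L where "out_str \<Phi> (trunc X L) (trunc Y n)" using X(2) out_ext_iff by blast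
      then have "\<not> induced \<Psi> (trunc Y n) < 2 ^ (i + k) * measure lam (?O n \<inter> cyl {\<beta>. (2 * (i + k), \<beta>) \<in> T})"
        using i unfolding cyl_Collect by blast
      then show ?thesis by (simp add: induced_def power_one_over field_simps)
    qed
    then show ?thesis by (intro exI[of _ "i + k"]) simp
  qed
  obtain C where C: "clopen_stages \<Psi> C" using ex_clopen_stages[OF assms(2)] by blast
  then have C_trunc: "\<And>M L X \<sigma>. M \<le> L \<Longrightarrow> C M (trunc X L) \<sigma> = C M (trunc X M) \<sigma>"
    and C_Suc: "\<And>M X \<sigma>. C M (trunc X M) \<sigma> \<Longrightarrow> C (Suc M) (trunc X (Suc M)) \<sigma>"
    and C_out: "\<And>X \<sigma>. out_ext \<Psi> X \<sigma> \<longleftrightarrow> (\<exists>M. C M (trunc X M) \<sigma>)"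
    unfolding clopen_stages_def by blast+
  define TD where "TD = {(i, s). \<exists>\<sigma> M.
      induced \<Psi> \<sigma> < card {v. v < 2 ^ M \<and> C M (str_of M v) \<sigma>} / 2 ^ M + (1/2) ^ (i + 1 + code_str \<sigma>) \<and>
      M \<le> length s \<and> out_str \<Psi> s \<sigma> \<and> \<not> C M s \<sigma>}"
  have TD: "ml_test TD"
    unfolding TD_def using assms(2,4) C by (rule ml_test_late_outputs)
  \<comment> \<open>An enumeration of all tests; \<open>TD\<close> witnesses that there is one, and
    it reappears below as some \<open>T j\<close>.\<close>
  define T where "T = from_nat_into {W. ml_test W}"
  have range_T: "range T = {W. ml_test W}"
    unfolding T_def using TD countable_ml_tests by (intro range_from_nat_into) auto
  \<comment> \<open>With \<open>p \<ge> j + 2\<close> the proportions are at most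
    \<open>(1/2) ^ (j + 2)\<close>, which sum to \<open>1/2\<close>, so the chosen components
    together leave at least half of every \<open>?O n\<close>.\<close>
  then have "\<forall>j. \<exists>p\<ge>j + 2. \<forall>n. measure lam (?O n \<inter> cyl {s. (2 * p, s) \<in> T j}) \<le> (1/2) ^ p * measure lam (?O n)"
    using small by blast
  then obtain p where p: "\<And>j. j + 2 \<le> p j"
    "\<And>j n. measure lam (?O n \<inter> cyl {s. (2 * p j, s) \<in> T j}) \<le> (1/2) ^ p j * measure lam (?O n)"
    by metis
  define V where "V j = cyl {s. (2 * p j, s) \<in> T j}" for j
  have half: "(\<lambda>j. (1/2) ^ (j + 2) * measure lam (?O n)) sums (1/2 * measure lam (?O n))" for n
  proof -
    have "(\<lambda>j. (1/2) ^ j * ((1/2) ^ 2 * measure lam (?O n))) sums (1 / (1 - 1/2) * ((1/2) ^ 2 * measure lam (?O n)))"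
      by (intro sums_mult2 geometric_sums) simp
    then show ?thesis by (simp add: power_add power2_eq_square mult.assoc)
  qed
  have "\<exists>Z. Z \<in> ?O n \<and> (\<forall>j. Z \<notin> V j)" for n
  proof (rule ccontr)
    assume no: "\<not> ?thesis"
    have le: "measure lam (?O n \<inter> V j) \<le> (1/2) ^ (j + 2) * measure lam (?O n)" for j
    proof -
      have "((1/2) ^ p j :: real) \<le> (1/2) ^ (j + 2)" by (rule power_decreasing[OF p(1)]) auto
      then have "(1/2) ^ p j * measure lam (?O n) \<le> (1/2) ^ (j + 2) * measure lam (?O n)"
        by (rule mult_right_mono) simp
      then show ?thesis using p(2)[of n j] unfolding V_def by linarith
    qed
    have summable: "summable (\<lambda>j. measure lam (?O n \<inter> V j))"
      by (rule summable_comparison_test'[OF sums_summable[OF half]]) (use le in simp)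
    have "?O n = (\<Union>j. ?O n \<inter> V j)" using no by blast
    then have "measure lam (?O n) = measure lam (\<Union>j. ?O n \<inter> V j)" by simp
    also have "\<dots> \<le> (\<Sum>j. measure lam (?O n \<inter> V j))"
      by (rule lam.finite_measure_subadditive_countably[OF _ summable])
        (auto simp: V_def intro!: sets.Int sets_out_ext sets_cyl)
    also have "\<dots> \<le> 1/2 * measure lam (?O n)"
      unfolding sums_unique[OF half] by (rule suminf_le[OF le summable sums_summable[OF half]])
    finally show False using pos[of n] by simp
  qed
  then obtain Zs where Zs: "\<And>n. out_ext \<Psi> (Zs n) (trunc Y n)" "\<And>n j. Zs n \<notin> V j"
    unfolding mem_Collect_eq by metis
  obtain Z where Z: "\<And>L. infinite {n. trunc (Zs n) L = trunc Z L}" using ex_cluster_point by blast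
  \<comment> \<open>Each \<open>V j\<close> is open: a cylinder around \<open>Z\<close> inside it
    would contain some \<open>Zs n\<close>.\<close>
  have Z_V: "Z \<notin> V j" for j
  proof
    assume "Z \<in> V j"
    then obtain s where s: "(2 * p j, s) \<in> T j" "trunc Z (length s) = s"
      by (auto simp: V_def cyl_def init_seg_iff)
    obtain n where "trunc (Zs n) (length s) = trunc Z (length s)"
      using Z[of "length s"] not_finite_existsD by blast
    then have "Zs n \<in> V j" using s by (auto simp: V_def cyl_def init_seg_iff)
    then show False using Zs(2) by blast
  qed
  have "Z \<in> MLR" unfolding MLR_def
  proof (intro CollectI allI impI)
    fix W assume "ml_test W"
    then obtain j where "W = T j" using range_T by blast
    then show "\<not> (\<forall>n. Z \<in> cyl {s. (n, s) \<in> W})" using Z_V[of j] unfolding V_def by blast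
  qed
  moreover have "out_ext \<Psi> Z (trunc Y m)" for m
  proof -
    let ?\<sigma> = "trunc Y m"
    obtain j where j: "TD = T j" using TD range_T by blast
    \<comment> \<open>At this level the component of \<open>TD\<close> is exactly
      \<open>V j\<close>, which every \<open>Zs n\<close> avoids.\<close>
    define i where "i = 2 * p j"
    have "induced \<Psi> ?\<sigma> - (1/2) ^ (i + 1 + code_str ?\<sigma>) < measure lam {X. \<exists>M. C M (trunc X M) ?\<sigma>}"
      unfolding induced_def C_out by simp
    moreover have "C M (trunc X M) ?\<sigma> \<Longrightarrow> C (Suc M) (trunc X (Suc M)) ?\<sigma>" for M X by (rule C_Suc)
    ultimately have "\<exists>M. induced \<Psi> ?\<sigma> - (1/2) ^ (i + 1 + code_str ?\<sigma>) <
        card {v. v < 2 ^ M \<and> C M (str_of M v) ?\<sigma>} / 2 ^ M"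
      by (subst (asm) less_measure_iff[of "\<lambda>M s. C M s ?\<sigma>"])
    then obtain M where M: "induced \<Psi> ?\<sigma> <
        card {v. v < 2 ^ M \<and> C M (str_of M v) ?\<sigma>} / 2 ^ M + (1/2) ^ (i + 1 + code_str ?\<sigma>)"
      unfolding diff_less_eq by blast
    \<comment> \<open>Agreement up to \<open>M\<close> lets the stage-\<open>M\<close> condition
      pass from \<open>Zs n\<close> to \<open>Z\<close>, while \<open>m \<le> n\<close> ensures that
      the output on \<open>Zs n\<close> extends \<open>trunc Y m\<close>.\<close>
    obtain n where n: "trunc (Zs n) M = trunc Z M" "m \<le> n"
      using Z[of M] unfolding infinite_nat_iff_unbounded_le by blast
    have "prefix ?\<sigma> (trunc Y n)" using n(2) by (simp add: prefix_trunc_iff init_seg_iff)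
    then have "out_ext \<Psi> (Zs n) ?\<sigma>" using Zs(1) out_ext_prefix by blast
    then obtain L where L: "out_str \<Psi> (trunc (Zs n) L) ?\<sigma>" by (auto simp: out_ext_iff)
    \<comment> \<open>\<open>L\<close> bits show the output, and \<open>M\<close> bits meet the
      length condition in \<open>TD\<close>.\<close>
    let ?s = "trunc (Zs n) (max L M)"
    have "prefix (trunc (Zs n) L) ?s" by (simp add: prefix_trunc_iff init_seg_iff)
    then have s: "out_str \<Psi> ?s ?\<sigma>" using L out_str_mono by blast
    have "(i, ?s) \<notin> TD"
    proof
      assume "(i, ?s) \<in> TD"
      then have "Zs n \<in> cyl {s. (i, s) \<in> TD}" unfolding cyl_Collect by blast
      then show False using Zs(2)[of n j] unfolding V_def j i_def by blast
    qed
    \<comment> \<open>Outside this component the output is not late: it has already appeared by the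
      good stage \<open>M\<close>.\<close>
    then have "C M ?s ?\<sigma>" using M s unfolding TD_def by (auto simp del: upt_Suc)
    then have "C M (trunc (Zs n) M) ?\<sigma>" using C_trunc[of M "max L M"] by simp
    then show ?thesis unfolding n(1) C_out by blast
  qed
  ultimately show "Y \<in> image_tf \<Psi> MLR" unfolding image_tf_iff[OF assms(2)] by blast
qed

theorem theorem3p1:
  assumes "turing_functional \<Phi>" and "turing_functional \<Psi>"
    and "induced \<Phi> = induced \<Psi>"
    and "computable_semimeasure (induced \<Phi>)"
  shows "image_tf \<Phi> MLR = image_tf \<Psi> MLR"
  using image_tf_MLR_subset[OF assms(1,2)] image_tf_MLR_subset[OF assms(2,1)] assms(3,4) by simp

end
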